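(* The following relations hold among sets of $n\times m$ matrices, for all $n,m$. (1) $\mathsf{TP}^{\mathrm{trop}}\subsetneq\operatorname{val}(\mathsf{TP})=\operatorname{val}(\mathsf{TN}(\mathbb{K}^* ))\subsetneq\operatorname{val}(\mathsf{TN})=\mathsf{TN}^{\mathrm{trop}}$. (2) $\mathsf{TP}^{\mathrm{trop}}=\mathsf{TP}^{\mathrm{trop}}_2$, which is the set of strict Monge matrices, and $\mathsf{TP}^{\mathrm{trop}}_2\subsetneq\mathsf{SDD}^{\mathrm{trop}}$. (3) $\operatorname{val}(\mathsf{TN}(\mathbb{K}^* ))=\mathsf{TN}^{\mathrm{trop}}(\mathbb{R})$, which is the set of Monge matrices, and this is exactly the set of staircase matrices up to diagonal scaling, i.e. the set of matrices of the form $(S_{ij}+u_i+v_j)_{i,j}$ with $S\in\mathbb{R}^{n\times m}$ a staircase matrix, $u\in\mathbb{R}^n$ and $v\in\mathbb{R}^m$. (4) $\mathsf{TN}^{\mathrm{trop}}=\mathsf{TN}^{\mathrm{trop}}_2\subsetneq\mathsf{DD}^{\mathrm{trop}}$. Moreover, in the special case of square matrices ($n=m$): (5) $\operatorname{val}(\mathsf{TP})\subsetneq\operatorname{val}(\mathrm{GL}_n\cap\mathsf{TN})=\langle\text{tropical Jacobi matrices}\rangle\subsetneq\operatorname{val}(\mathsf{TN})$. (6) $\operatorname{val}(\mathrm{GL}_n\cap\mathsf{TN})=\{A\in\mathsf{TN}^{\mathrm{trop}}:\operatorname{per}(A)\ne-\infty\}$.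
   Context: $\mathbb{K}$ is the field of generalized Puiseux series with real coefficients and real exponents: series $f=\sum_{k\ge 0}a_kt^{b_k}$ with $a_k\in\mathbb{R}$ and $(b_k)$ a finite sequence, or a strictly decreasing sequence of reals tending to $-\infty$. The valuation $\operatorname{val}(f)$ is the largest exponent with nonzero coefficient, $\operatorname{val}(0)=-\infty$. $\mathbb{K}$ is ordered: a nonzero series is positive if its leading coefficient (that of the largest exponent) is positive. $\mathbb{K}^*=\mathbb{K}\setminus\{0\}$. $\mathsf{TP}$ (resp. $\mathsf{TN}$) is the set of matrices over $\mathbb{K}$ all of whose minors are positive (resp. nonnegative); $\mathsf{TN}(\mathbb{K}^* )$ is the subset of $\mathsf{TN}$ of matrices with all entries nonzero; $\mathrm{GL}_n$ is the set of invertible $n\times n$ matrices over $\mathbb{K}$. $\operatorname{val}$ is applied to matrices entrywise. $\mathbb{R}_{\max}=\mathbb{R}\cup\{-\infty\}$ with $a\oplus b=\max(a,b)$, $a\odot b=a+b$. For a $d\times d$ matrix $M$ over $\mathbb{R}_{\max}$, $\operatorname{per}(M)=\max_{\sigma\in S_d}\sum_iM_{i,\sigma(i)}$; the weight of $\sigma$ is $\sum_iM_{i,\sigma(i)}$. $M$ is sign-nonsingular if $\operatorname{per}(M)\ne-\infty$ and all permutations of maximum weight have the same parity, and sign-singular otherwise. A tropical minor is the tropical permanent of a square submatrix (rows and columns in natural order). It is tropically positive if it is finite and all maximum-weight permutations of the submatrix are even; it is tropically nonnegative if it is tropically positive or the submatrix is sign-singular. $\mathsf{TP}^{\mathrm{trop}}$: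 matrices with entries in $\mathbb{R}$ all of whose tropical minors are tropically positive. $\mathsf{TN}^{\mathrm{trop}}$: matrices with entries in $\mathbb{R}_{\max}$ all of whose tropical minors are tropically nonnegative; $\mathsf{TN}^{\mathrm{trop}}(\mathbb{R})$: its elements with all entries in $\mathbb{R}$. $\mathsf{TP}^{\mathrm{trop}}_2$ and $\mathsf{TN}^{\mathrm{trop}}_2$: matrices over $\mathbb{R}_{\max}$ all of whose tropical minors of size at most $2$ are tropically positive, resp. tropically nonnegative. A real matrix $A$ is a Monge matrix if $A_{i,j}+A_{i',j'}\ge A_{i,j'}+A_{i',j}$ for all $i<i'$, $j<j'$, and a strict Monge matrix if all these inequalities are strict. A square matrix $M$ over $\mathbb{R}_{\max}$ is tropical diagonally dominant if $\operatorname{per}(M)=\sum_iM_{i,i}$, and tropical strictly diagonally dominant if $\operatorname{per}(M)>\sum_iM_{i,\sigma(i)}$ for every permutation $\sigma\ne\mathrm{Id}$. $\mathsf{DD}^{\mathrm{trop}}$ (resp. $\mathsf{SDD}^{\mathrm{trop}}$) is the set of matrices over $\mathbb{R}_{\max}$ all of whose square submatrices (rows and columns in natural order) are tropical diagonally dominant (resp. tropical strictly diagonally dominant). For $2\le i\le n$, $2\le j\le m$, the elementary staircase matrix $L^{(i,j)}\in\mathbb{R}^{n\times m}$ has $(t,s)$ entry $1$ if $t\ge i$ and $s\ge j$, and $0$ otherwise. A staircase matrix is a nonnegative real linear combination of elementary staircase matrices. A tropical Jacobi matrix is an $n\times n$ matrix that differs from the tropical identity matrix ($0$ on the diagonal,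 $-\infty$ elsewhere) in at most one entry, which must be finite and located on the main diagonal or immediately above or below it. $\langle\cdot\rangle$ denotes the semigroup of all finite products, for the tropical product $(A\odot B)_{ij}=\max_k(A_{ik}+B_{kj})$. The symbol $\subsetneq$ denotes strict inclusion.
   Formalization: In (4), TN^trop_2 equals DD^trop with the given definitions, so equality replaces strict inclusion. In (1), TP^trop ⊂ val(TP) is strict only for n,m ≥ 2, and in (5), val(TP) ⊂ val(GL_n ∩ TN) only for n ≥ 2; otherwise each pair coincides. Sizes n,m ≥ 1. *)

theory Defs
  imports "Jordan_Normal_Form.Determinant" "Jordan_Normal_Form.DL_Submatrix"
begin

section \<open>Generalized Puiseux series\<close>

definition puiseux_supp :: "real set \<Rightarrow> bool" where
  "puiseux_supp S \<longleftrightarrow>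
     finite S \<or> (\<exists>e :: nat \<Rightarrow> real. monotone (<) (>) e \<and> filterlim e at_bot sequentially \<and> S = range e)"

lemma greatest_of_left_finite:
  fixes S :: "real set"
  assumes "\<And>c. finite {x \<in> S. c \<le> x}" and "S \<noteq> {}"
  shows "\<exists>a\<in>S. \<forall>x\<in>S. x \<le> a"
proof -
  obtain s where s: "s \<in> S" using assms(2) by auto
  let ?T = "{x \<in> S. s \<le> x}"
  have T: "finite ?T" "?T \<noteq> {}" using assms(1) s by auto
  have "Max ?T \<in> ?T" using Max_in[OF T] .
  moreover have "x \<le> Max ?T" if "x \<in> S" for x
  proof (cases "s \<le> x")
    case True
    then show ?thesis using Max_ge[OF T(1)] that by auto
  next
    case False
    then show ?thesis using Max_ge[OF T(1), of s] s by auto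
  qed
  ultimately show ?thesis by blast
qed

lemma puiseux_supp_iff: "puiseux_supp S \<longleftrightarrow> (\<forall>c. finite {x \<in> S. c \<le> x})"
proof
  assume "puiseux_supp S"
  then consider "finite S"
    | e :: "nat \<Rightarrow> real" where "filterlim e at_bot sequentially" "S = range e"
    unfolding puiseux_supp_def by blast
  then show "\<forall>c. finite {x \<in> S. c \<le> x}"
  proof cases
    case 2
    show ?thesis
    proof
      fix c
      from 2(1) have "eventually (\<lambda>n. e n < c) sequentially"
        by (simp add: filterlim_at_bot_dense)
      then obtain N where N: "\<And>n. n \<ge> N \<Longrightarrow> e n < c"
        by (auto simp: eventually_sequentially)
      have "{x \<in> S. c \<le> x} \<subseteq> e ` {..<N}"
        using N 2(2) by (auto simp: not_le[symmetric]) (meson imageI lessThan_iff not_le)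
      then show "finite {x \<in> S. c \<le> x}" by (rule finite_subset) auto
    qed
  qed auto
next
  assume fin: "\<forall>c. finite {x \<in> S. c \<le> x}"
  show "puiseux_supp S"
  proof (cases "finite S")
    case True
    then show ?thesis by (simp add: puiseux_supp_def)
  next
    case inf: False
    have ex: "\<exists>y\<in>S. y < c \<and> (\<forall>x\<in>S. x < c \<longrightarrow> x \<le> y)" for c
    proof -
      have "{x \<in> S. x < c} \<noteq> {}"
      proof
        assume "{x \<in> S. x < c} = {}"
        then have "{x \<in> S. c \<le> x} = S" by force
        then show False using fin inf by metis
      qed
      moreover have "finite {x \<in> {x \<in> S. x < c}. d \<le> x}" for d
        by (rule finite_subset[OF _ fin[rule_format, of d]]) auto
      ultimately have "\<exists>a\<in>{x \<in> S. x < c}. \<forall>x\<in>{x \<in> S. x < c}. x \<le> a"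
        by (intro greatest_of_left_finite) auto
      then show ?thesis by auto
    qed
    define nxt where "nxt c = (SOME y. y \<in> S \<and> y < c \<and> (\<forall>x\<in>S. x < c \<longrightarrow> x \<le> y))" for c
    have nxt: "nxt c \<in> S" "nxt c < c" "\<And>x. x \<in> S \<Longrightarrow> x < c \<Longrightarrow> x \<le> nxt c" for c
      using someI_ex[of "\<lambda>y. y \<in> S \<and> y < c \<and> (\<forall>x\<in>S. x < c \<longrightarrow> x \<le> y)"] ex[of c]
      unfolding nxt_def by blast+
    obtain a where a: "a \<in> S" "\<forall>x\<in>S. x \<le> a"
      using greatest_of_left_finite[of S] fin inf by force
    define e where "e n = (nxt ^^ n) a" for n
    have e0: "e 0 = a" and eS: "e (Suc n) = nxt (e n)" for n by (simp_all add: e_def)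
    have in_S: "e n \<in> S" for n by (cases n) (simp_all add: e0 eS a nxt)
    have dec: "e n < e m" if "m < n" for m n
      using that by (induction n) (auto simp: eS less_Suc_eq intro: less_trans[OF nxt(2)] nxt(2))
    have inj: "inj e" by (rule injI) (metis dec less_irrefl linorder_neqE_nat)
    have sub: "x \<in> range e" if x: "x \<in> S" for x
    proof (rule ccontr)
      assume nr: "x \<notin> range e"
      have "x \<le> e n" for n
      proof (induction n)
        case 0
        then show ?case using a x by (simp add: e0)
      next
        case (Suc n)
        moreover have "x \<noteq> e n" using nr by auto
        ultimately show ?case using nxt(3)[OF x, of "e n"] by (simp add: eS)
      qed
      then have "range e \<subseteq> {y \<in> S. x \<le> y}" using in_S by auto
      then have "finite (range e)" using fin finite_subset by blast
      then show False using inj finite_imageD by fastforce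
    qed
    have lim: "filterlim e at_bot sequentially"
      unfolding filterlim_at_bot_dense
    proof
      fix c
      have "e ` {n. c \<le> e n} \<subseteq> {y \<in> S. c \<le> y}" using in_S by auto
      then have "finite (e ` {n. c \<le> e n})" using fin finite_subset by blast
      then have "finite {n. c \<le> e n}" using inj by (meson finite_imageD inj_on_subset subset_UNIV)
      then have "eventually (\<lambda>n. \<not> c \<le> e n) sequentially"
        by (simp add: eventually_cofinite cofinite_eq_sequentially[symmetric])
      then show "eventually (\<lambda>n. e n < c) sequentially" by (simp add: not_le)
    qed
    have "S = range e" using sub in_S by auto
    then show ?thesis
      unfolding puiseux_supp_def using lim dec by (auto simp: monotone_def)
  qed
qed

text \<open>A series is represented by its coefficient function, sending \<^term>\<open>b :: real\<close> to the
  coefficient of $t^b$.\<close>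

typedef puiseux = "{f :: real \<Rightarrow> real. puiseux_supp {b. f b \<noteq> 0}}"
  morphisms coeff_of Abs_puiseux
  by (rule exI[of _ "\<lambda>_. 0"]) (simp add: puiseux_supp_def)

setup_lifting type_definition_puiseux

lemma puiseux_eqI: "(\<And>b. coeff_of f b = coeff_of g b) \<Longrightarrow> f = g"
  by transfer auto

lemma finite_coeff: "finite {x. coeff_of f x \<noteq> 0 \<and> c \<le> x}"
  using coeff_of[of f] by (auto simp: puiseux_supp_iff)

lemma coeff_bound: obtains B where "\<And>x. coeff_of f x \<noteq> 0 \<Longrightarrow> x \<le> B"
proof (cases "{x. coeff_of f x \<noteq> 0} = {}")
  case True
  then show ?thesis using that by blast
next
  case False
  then have "\<exists>a\<in>{x. coeff_of f x \<noteq> 0}. \<forall>x\<in>{x. coeff_of f x \<noteq> 0}. x \<le> a"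
    by (intro greatest_of_left_finite) (use finite_coeff in auto)
  then show ?thesis using that by blast
qed

definition conv :: "(real \<Rightarrow> real) \<Rightarrow> (real \<Rightarrow> real) \<Rightarrow> real \<Rightarrow> real" where
  "conv f g c = (\<Sum>x | f x \<noteq> 0 \<and> g (c - x) \<noteq> 0. f x * g (c - x))"

lemma conv_superset:
  assumes "finite A" "\<And>x. f x \<noteq> 0 \<Longrightarrow> g (c - x) \<noteq> 0 \<Longrightarrow> x \<in> A"
  shows "conv f g c = (\<Sum>x\<in>A. f x * g (c - x))"
  unfolding conv_def by (rule sum.mono_neutral_left) (use assms in auto)

lemma conv_nonzeroD:
  assumes "conv f g c \<noteq> 0"
  obtains x where "f x \<noteq> 0" "g (c - x) \<noteq> 0"
  using assms sum.neutral[of "{x. f x \<noteq> 0 \<and> g (c - x) \<noteq> 0}"] unfolding conv_def by blast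

lemma conv_support:
  assumes f: "puiseux_supp {b. f b \<noteq> 0}" and g: "puiseux_supp {b. g b \<noteq> 0}"
  shows "puiseux_supp {b. conv f g b \<noteq> 0}"
proof -
  from f obtain F where F: "coeff_of F = f" using coeff_of_cases by blast
  from g obtain G where G: "coeff_of G = g" using coeff_of_cases by blast
  obtain Bf where Bf: "\<And>x. f x \<noteq> 0 \<Longrightarrow> x \<le> Bf" using coeff_bound[of F] F by metis
  obtain Bg where Bg: "\<And>x. g x \<noteq> 0 \<Longrightarrow> x \<le> Bg" using coeff_bound[of G] G by metis
  have "finite {x. conv f g x \<noteq> 0 \<and> c \<le> x}" for c
  proof -
    have "{x. conv f g x \<noteq> 0 \<and> c \<le> x} \<subseteq>
      (\<lambda>(x, y). x + y) ` ({x. f x \<noteq> 0 \<and> c - Bg \<le> x} \<times> {x. g x \<noteq> 0 \<and> c - Bf \<le> x})"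
    proof
      fix z assume "z \<in> {x. conv f g x \<noteq> 0 \<and> c \<le> x}"
      then obtain x where x: "f x \<noteq> 0" "g (z - x) \<noteq> 0" "c \<le> z" by (auto elim: conv_nonzeroD)
      have "x \<le> Bf" "z - x \<le> Bg" using Bf Bg x by auto
      then have "(x, z - x) \<in> {x. f x \<noteq> 0 \<and> c - Bg \<le> x} \<times> {x. g x \<noteq> 0 \<and> c - Bf \<le> x}"
        using x by auto
      then show "z \<in> (\<lambda>(x, y). x + y) ` ({x. f x \<noteq> 0 \<and> c - Bg \<le> x} \<times> {x. g x \<noteq> 0 \<and> c - Bf \<le> x})"
        by (rule rev_image_eqI) simp
    qed
    then show ?thesis
      by (rule finite_subset) (use finite_coeff[of F] finite_coeff[of G] F G in auto)
  qed
  then show ?thesis by (auto simp: puiseux_supp_iff)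
qed

instantiation puiseux :: "{zero, one, plus, minus, uminus, times}"
begin

lift_definition zero_puiseux :: puiseux is "\<lambda>_. 0"
  by (simp add: puiseux_supp_def)

lift_definition one_puiseux :: puiseux is "\<lambda>b. if b = 0 then 1 else 0"
  by (simp add: puiseux_supp_def)

lift_definition plus_puiseux :: "puiseux \<Rightarrow> puiseux \<Rightarrow> puiseux" is "\<lambda>f g b. f b + g b"
proof -
  fix f g :: "real \<Rightarrow> real"
  assume "puiseux_supp {b. f b \<noteq> 0}" "puiseux_supp {b. g b \<noteq> 0}"
  then have "finite ({x. f x \<noteq> 0 \<and> c \<le> x} \<union> {x. g x \<noteq> 0 \<and> c \<le> x})" for c
    by (auto simp: puiseux_supp_iff)
  then have "finite {x. f x + g x \<noteq> 0 \<and> c \<le> x}" for c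
    by (rule rev_finite_subset) auto
  then show "puiseux_supp {b. f b + g b \<noteq> 0}" by (auto simp: puiseux_supp_iff)
qed

lift_definition uminus_puiseux :: "puiseux \<Rightarrow> puiseux" is "\<lambda>f b. - f b"
  by simp

definition minus_puiseux :: "puiseux \<Rightarrow> puiseux \<Rightarrow> puiseux" where
  "f - g = f + (- g)" for f g :: puiseux

lift_definition times_puiseux :: "puiseux \<Rightarrow> puiseux \<Rightarrow> puiseux" is conv
  by (rule conv_support)

instance ..
end

lemma coeff_0 [simp]: "coeff_of 0 b = 0" by transfer simp
lemma coeff_1: "coeff_of 1 b = (if b = 0 then 1 else 0)" by transfer simp
lemma coeff_add [simp]: "coeff_of (f + g) b = coeff_of f b + coeff_of g b" by transfer simp
lemma coeff_uminus [simp]: "coeff_of (- f) b = - coeff_of f b" by transfer simp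
lemma coeff_diff [simp]: "coeff_of (f - g) b = coeff_of f b - coeff_of g b"
  by (simp add: minus_puiseux_def)
lemma coeff_mult: "coeff_of (f * g) b = conv (coeff_of f) (coeff_of g) b"
  by transfer simp

lemma coeff_mult_cut:
  assumes "\<And>x. coeff_of g x \<noteq> 0 \<Longrightarrow> x \<le> B" "c - B \<ge> d"
  shows "coeff_of (f * g) c = (\<Sum>x | coeff_of f x \<noteq> 0 \<and> d \<le> x. coeff_of f x * coeff_of g (c - x))"
  unfolding coeff_mult
proof (rule conv_superset[OF finite_coeff])
  fix x assume "coeff_of f x \<noteq> 0" "coeff_of g (c - x) \<noteq> 0"
  moreover from this have "c - x \<le> B" using assms by auto
  ultimately show "x \<in> {x. coeff_of f x \<noteq> 0 \<and> d \<le> x}" using assms(2) by auto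
qed

lemma coeff_mult_nonzeroD:
  assumes "coeff_of (f * g) c \<noteq> 0"
  obtains x where "coeff_of f x \<noteq> 0" "coeff_of g (c - x) \<noteq> 0"
  using assms unfolding coeff_mult by (rule conv_nonzeroD)

lemma puiseux_mult_comm: "f * g = g * f" for f g :: puiseux
proof (rule puiseux_eqI)
  fix c
  show "coeff_of (f * g) c = coeff_of (g * f) c"
    unfolding coeff_mult conv_def
    by (rule sum.reindex_bij_witness[of _ "\<lambda>x. c - x" "\<lambda>x. c - x"]) auto
qed

lemma puiseux_mult_assoc: "(f * g) * h = f * (g * h)" for f g h :: puiseux
proof (rule puiseux_eqI)
  fix c
  let ?f = "coeff_of f" and ?g = "coeff_of g" and ?h = "coeff_of h"
  obtain Bf where Bf: "\<And>x. ?f x \<noteq> 0 \<Longrightarrow> x \<le> Bf" using coeff_bound by metis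
  obtain Bg where Bg: "\<And>x. ?g x \<noteq> 0 \<Longrightarrow> x \<le> Bg" using coeff_bound by metis
  obtain Bh where Bh: "\<And>x. ?h x \<noteq> 0 \<Longrightarrow> x \<le> Bh" using coeff_bound by metis
  have Bgh: "x \<le> Bg + Bh" if nz: "coeff_of (g * h) x \<noteq> 0" for x
  proof -
    obtain y where "?g y \<noteq> 0" "?h (x - y) \<noteq> 0" using coeff_mult_nonzeroD[OF nz] by blast
    then show ?thesis using Bg Bh by force
  qed
  define A where "A = {x. ?f x \<noteq> 0 \<and> c - (Bg + Bh) \<le> x}"
  define B where "B = {x. ?g x \<noteq> 0 \<and> c - (Bf + Bh) \<le> x}"
  define W where "W = (\<lambda>(x, y). x + y) ` (A \<times> B)"
  have fin: "finite A" "finite B" "finite W"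
    using finite_coeff by (auto simp: A_def B_def W_def)
  have W: "x + y \<in> W" if "?f x \<noteq> 0" "?g y \<noteq> 0" "?h (c - (x + y)) \<noteq> 0" for x y
  proof -
    have "x \<le> Bf" "y \<le> Bg" "c - (x + y) \<le> Bh" using that Bf Bg Bh by auto
    then have "(x, y) \<in> A \<times> B" using that by (auto simp: A_def B_def)
    then show ?thesis unfolding W_def by (rule rev_image_eqI) simp
  qed
  have "coeff_of ((f * g) * h) c = (\<Sum>w\<in>W. coeff_of (f * g) w * ?h (c - w))"
    unfolding coeff_mult[of "f * g"]
  proof (rule conv_superset[OF fin(3)])
    fix w assume w: "coeff_of (f * g) w \<noteq> 0" "?h (c - w) \<noteq> 0"
    obtain x where "?f x \<noteq> 0" "?g (w - x) \<noteq> 0" using coeff_mult_nonzeroD[OF w(1)] by blast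
    then show "w \<in> W" using W[of x "w - x"] w by simp
  qed
  also have "\<dots> = (\<Sum>w\<in>W. \<Sum>x\<in>A. ?f x * (?g (w - x) * ?h (c - w)))"
  proof (rule sum.cong[OF refl])
    fix w
    show "coeff_of (f * g) w * ?h (c - w) = (\<Sum>x\<in>A. ?f x * (?g (w - x) * ?h (c - w)))"
    proof (cases "?h (c - w) = 0")
      case False
      then have "c - w \<le> Bh" using Bh by auto
      then have "coeff_of (f * g) w = (\<Sum>x\<in>A. ?f x * ?g (w - x))"
        unfolding A_def using Bg by (intro coeff_mult_cut[of g Bg]) auto
      then show ?thesis by (simp add: sum_distrib_right mult.assoc)
    qed simp
  qed
  also have "\<dots> = (\<Sum>x\<in>A. ?f x * (\<Sum>w\<in>W. ?g (w - x) * ?h (c - w)))"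
    by (subst sum.swap) (simp add: sum_distrib_left)
  also have "\<dots> = (\<Sum>x\<in>A. ?f x * coeff_of (g * h) (c - x))"
  proof (rule sum.cong[OF refl])
    fix x assume x: "x \<in> A"
    have "(\<Sum>w\<in>W. ?g (w - x) * ?h (c - w)) = (\<Sum>y\<in>(\<lambda>w. w - x) ` W. ?g y * ?h (c - x - y))"
      by (subst sum.reindex) (auto simp: inj_on_def)
    also have "\<dots> = coeff_of (g * h) (c - x)"
      unfolding coeff_mult
    proof (rule conv_superset[symmetric])
      fix y assume y: "?g y \<noteq> 0" "?h (c - x - y) \<noteq> 0"
      have "x + y \<in> W" using W[of x y] x y by (auto simp: A_def algebra_simps)
      then show "y \<in> (\<lambda>w. w - x) ` W" by (rule rev_image_eqI) simp
    qed (use fin in auto)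
    finally show "?f x * (\<Sum>w\<in>W. ?g (w - x) * ?h (c - w)) = ?f x * coeff_of (g * h) (c - x)"
      by simp
  qed
  also have "\<dots> = coeff_of (f * (g * h)) c"
    unfolding A_def using Bgh by (intro coeff_mult_cut[symmetric, of "g * h" "Bg + Bh"]) auto
  finally show "coeff_of (f * g * h) c = coeff_of (f * (g * h)) c" .
qed

lemma puiseux_distrib: "(f + g) * h = f * h + g * h" for f g h :: puiseux
proof (rule puiseux_eqI)
  fix c
  obtain B where B: "\<And>x. coeff_of h x \<noteq> 0 \<Longrightarrow> x \<le> B" using coeff_bound by metis
  let ?A = "{x. coeff_of f x \<noteq> 0 \<and> c - B \<le> x} \<union> {x. coeff_of g x \<noteq> 0 \<and> c - B \<le> x}"
  have *: "coeff_of (p * h) c = (\<Sum>x\<in>?A. coeff_of p x * coeff_of h (c - x))"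
    if "\<And>x. coeff_of p x \<noteq> 0 \<Longrightarrow> coeff_of f x \<noteq> 0 \<or> coeff_of g x \<noteq> 0" for p
    unfolding coeff_mult
  proof (rule conv_superset)
    show "finite ?A" using finite_coeff by auto
  next
    fix x assume x: "coeff_of p x \<noteq> 0" "coeff_of h (c - x) \<noteq> 0"
    then have "c - x \<le> B" using B by auto
    then show "x \<in> ?A" using that[OF x(1)] by auto
  qed
  show "coeff_of ((f + g) * h) c = coeff_of (f * h + g * h) c"
    using *[of "f + g"] *[of f] *[of g] by (auto simp: sum.distrib distrib_right)
qed

instance puiseux :: comm_ring_1
proof
  fix a b c :: puiseux
  show "a + b + c = a + (b + c)" "a + b = b + a" "0 + a = a" "- a + a = 0" "a - b = a + - b"
    by (rule puiseux_eqI; simp)+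
  show "a * b * c = a * (b * c)" by (rule puiseux_mult_assoc)
  show "a * b = b * a" by (rule puiseux_mult_comm)
  show "1 * a = a"
  proof (rule puiseux_eqI)
    fix c show "coeff_of (1 * a) c = coeff_of a c"
      unfolding coeff_mult by (subst conv_superset[of "{0}"]) (auto simp: coeff_1 split: if_splits)
  qed
  show "(a + b) * c = a * c + b * c" by (rule puiseux_distrib)
  show "(0 :: puiseux) \<noteq> 1"
    by (metis coeff_0 coeff_1 zero_neq_one)
qed

definition lead_exp :: "puiseux \<Rightarrow> real" where
  "lead_exp f = (GREATEST b. coeff_of f b \<noteq> 0)"

lemma lead_exp_eqI:
  assumes "coeff_of f a \<noteq> 0" "\<And>x. x > a \<Longrightarrow> coeff_of f x = 0"
  shows "lead_exp f = a"
  unfolding lead_exp_def by (rule Greatest_equality) (use assms in \<open>auto simp: not_less[symmetric]\<close>)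

lemma lead_expE:
  assumes "f \<noteq> 0"
  shows coeff_lead_exp: "coeff_of f (lead_exp f) \<noteq> 0"
    and coeff_above_lead_exp: "x > lead_exp f \<Longrightarrow> coeff_of f x = 0"
proof -
  have "{x. coeff_of f x \<noteq> 0} \<noteq> {}" using assms puiseux_eqI[of f 0] by auto
  then obtain a where a: "coeff_of f a \<noteq> 0" "\<And>x. coeff_of f x \<noteq> 0 \<Longrightarrow> x \<le> a"
    using greatest_of_left_finite[of "{x. coeff_of f x \<noteq> 0}"] finite_coeff[of f] by auto
  then have "lead_exp f = a" by (intro lead_exp_eqI) (auto simp: not_le[symmetric])
  then show "coeff_of f (lead_exp f) \<noteq> 0" "x > lead_exp f \<Longrightarrow> coeff_of f x = 0"
    using a by (auto simp: not_le[symmetric])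
qed

lemma coeff_mult_top:
  assumes "\<And>x. x > a \<Longrightarrow> coeff_of f x = 0" "\<And>x. x > b \<Longrightarrow> coeff_of g x = 0"
  shows "coeff_of (f * g) (a + b) = coeff_of f a * coeff_of g b"
    and "x > a + b \<Longrightarrow> coeff_of (f * g) x = 0"
proof -
  show "coeff_of (f * g) (a + b) = coeff_of f a * coeff_of g b"
    unfolding coeff_mult
  proof (subst conv_superset[of "{a}"])
    fix x assume x: "coeff_of f x \<noteq> 0" "coeff_of g (a + b - x) \<noteq> 0"
    have "\<not> x > a" "\<not> a + b - x > b" using x assms by blast+
    then show "x \<in> {a}" by auto
  qed auto
  show "coeff_of (f * g) x = 0" if "x > a + b"
  proof (rule ccontr)
    assume "coeff_of (f * g) x \<noteq> 0"
    then obtain y where y: "coeff_of f y \<noteq> 0" "coeff_of g (x - y) \<noteq> 0"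
      by (rule coeff_mult_nonzeroD)
    have "\<not> y > a" "\<not> x - y > b" using y assms by blast+
    then show False using that by auto
  qed
qed

subsection \<open>Inverses\<close>

lemma ex_inverse_unit:
  assumes u: "\<And>x. x \<ge> 0 \<Longrightarrow> coeff_of u x = 0"
  shows "\<exists>g. (1 - u) * g = 1"
proof -
  obtain d where d: "d > 0" "\<And>x. x > - d \<Longrightarrow> coeff_of u x = 0"
  proof (cases "u = 0")
    case True
    then show ?thesis using that[of 1] by auto
  next
    case False
    have "lead_exp u < 0" using coeff_lead_exp[OF False] u by (meson not_le)
    then show ?thesis using that[of "- lead_exp u"] coeff_above_lead_exp[OF False] by auto
  qed
  have pow: "coeff_of (u ^ n) x = 0" if "x > - (real n * d)" for n x
    using that
  proof (induction n arbitrary: x)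
    case 0
    then show ?case by (simp add: coeff_1)
  next
    case (Suc n)
    have "coeff_of (u * u ^ n) x = 0"
      by (rule coeff_mult_top(2)[of "- d" _ "- (real n * d)"])
        (use Suc d in \<open>auto simp: algebra_simps\<close>)
    then show ?case by simp
  qed
  define N where "N c = nat \<lceil>- c / d\<rceil>" for c
  have N: "coeff_of (u ^ n) x = 0" if "n > N c" "c \<le> x" for n c x
  proof (rule pow)
    have "- c / d < real n" using that(1) unfolding N_def by linarith
    then have "- c < real n * d" using d(1) by (simp add: field_simps)
    then show "- (real n * d) < x" using that(2) by linarith
  qed
  define g0 where "g0 c = (\<Sum>n\<le>N c. coeff_of (u ^ n) c)" for c
  have g0: "g0 x = coeff_of (\<Sum>n\<le>N c. u ^ n) x" if "c \<le> x" for c x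
  proof -
    have "N x \<le> N c" unfolding N_def using that d(1)
      by (intro nat_mono ceiling_mono) (simp add: divide_right_mono)
    then have "(\<Sum>n\<le>N x. coeff_of (u ^ n) x) = (\<Sum>n\<le>N c. coeff_of (u ^ n) x)"
      by (intro sum.mono_neutral_left) (auto intro: N[of x])
    moreover have "(\<Sum>n\<le>M. coeff_of (u ^ n) x) = coeff_of (\<Sum>n\<le>M. u ^ n) x" for M :: nat
      by (induction M) auto
    ultimately show ?thesis by (simp add: g0_def)
  qed
  have "finite {x. g0 x \<noteq> 0 \<and> c \<le> x}" for c
  proof -
    have "{x. g0 x \<noteq> 0 \<and> c \<le> x} \<subseteq> {x. coeff_of (\<Sum>n\<le>N c. u ^ n) x \<noteq> 0 \<and> c \<le> x}"
      using g0[of c] by auto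
    then show ?thesis by (rule finite_subset) (rule finite_coeff)
  qed
  then have "puiseux_supp {x. g0 x \<noteq> 0}" by (auto simp: puiseux_supp_iff)
  then obtain g where g: "coeff_of g = g0" using coeff_of_cases by blast
  have "(1 - u) * g = 1"
  proof (rule puiseux_eqI)
    fix c
    let ?G = "\<Sum>n\<le>N c. u ^ n"
    have 1: "coeff_of (1 - u) x = 0" if "x > 0" for x using that u by (auto simp: coeff_1)
    have 2: "coeff_of (g - ?G) x = 0" if "x \<ge> c" for x using g0[OF that] g by simp
    have "coeff_of ((1 - u) * (g - ?G)) c = 0"
    proof (rule ccontr)
      assume "coeff_of ((1 - u) * (g - ?G)) c \<noteq> 0"
      then obtain y where y: "coeff_of (1 - u) y \<noteq> 0" "coeff_of (g - ?G) (c - y) \<noteq> 0"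
        by (rule coeff_mult_nonzeroD)
      have "\<not> y > 0" "\<not> c - y \<ge> c" using y 1 2 by blast+
      then show False by auto
    qed
    then have "coeff_of ((1 - u) * g) c = coeff_of ((1 - u) * ?G) c"
      by (simp only: right_diff_distrib) simp
    also have "(1 - u) * ?G = 1 - u ^ Suc (N c)"
      using one_diff_power_eq[of u "Suc (N c)"] by (simp add: lessThan_Suc_atMost del: power_Suc)
    also have "coeff_of (1 - u ^ Suc (N c)) c = coeff_of 1 c"
      using N[of c "Suc (N c)" c] by (simp del: power_Suc)
    finally show "coeff_of ((1 - u) * g) c = coeff_of 1 c" .
  qed
  then show ?thesis ..
qed

lift_definition t_monom :: "real \<Rightarrow> real \<Rightarrow> puiseux" is "\<lambda>a b x. if x = b then a else 0"
  by (simp add: puiseux_supp_def)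

lemma coeff_t_monom: "coeff_of (t_monom a b) x = (if x = b then a else 0)"
  by transfer simp

lemma ex_inverse_puiseux:
  fixes f :: puiseux
  assumes "f \<noteq> 0"
  shows "\<exists>g. g * f = 1"
proof -
  define b a where "b = lead_exp f" and "a = coeff_of f b"
  have a: "a \<noteq> 0" using coeff_lead_exp[OF assms] by (simp add: a_def b_def)
  define m where "m = t_monom (1 / a) (- b)"
  have top: "coeff_of (m * f) (- b + b) = coeff_of m (- b) * coeff_of f b"
    and above: "\<And>x. x > - b + b \<Longrightarrow> coeff_of (m * f) x = 0"
    using coeff_mult_top[of "- b" m b f] coeff_above_lead_exp[OF assms]
    by (auto simp: b_def m_def coeff_t_monom)
  have "coeff_of (1 - m * f) x = 0" if "x \<ge> 0" for x
    using that top above[of x] a by (cases "x = 0") (auto simp: coeff_1 m_def coeff_t_monom a_def)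
  then obtain g where "(1 - (1 - m * f)) * g = 1" using ex_inverse_unit by blast
  then have "(g * m) * f = 1" by (simp add: ac_simps)
  then show ?thesis ..
qed

instantiation puiseux :: field
begin

definition inverse_puiseux :: "puiseux \<Rightarrow> puiseux" where
  "inverse f = (if f = 0 then 0 else (SOME g. g * f = 1))" for f :: puiseux

definition divide_puiseux :: "puiseux \<Rightarrow> puiseux \<Rightarrow> puiseux" where
  "f div g = f * inverse g" for f g :: puiseux

instance
proof
  fix f g :: puiseux
  show "inverse f * f = 1" if "f \<noteq> 0"
    using someI_ex[OF ex_inverse_puiseux[OF that]] that by (simp add: inverse_puiseux_def)
qed (simp_all add: inverse_puiseux_def divide_puiseux_def)
end

subsection \<open>The ordering\<close>

definition puiseux_pos :: "puiseux \<Rightarrow> bool" where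
  "puiseux_pos f \<longleftrightarrow> f \<noteq> 0 \<and> coeff_of f (lead_exp f) > 0"

lemma puiseux_posI:
  assumes "coeff_of f a > 0" "\<And>x. x > a \<Longrightarrow> coeff_of f x = 0"
  shows "puiseux_pos f"
proof -
  have "lead_exp f = a" by (rule lead_exp_eqI) (use assms in auto)
  then show ?thesis using assms(1) by (auto simp: puiseux_pos_def)
qed

lemma puiseux_posE:
  assumes "puiseux_pos f"
  obtains a where "coeff_of f a > 0" "\<And>x. x > a \<Longrightarrow> coeff_of f x = 0"
  using assms coeff_above_lead_exp unfolding puiseux_pos_def by blast

lemma puiseux_pos_add:
  assumes "puiseux_pos f" "puiseux_pos g"
  shows "puiseux_pos (f + g)"
proof -
  obtain a where a: "coeff_of f a > 0" "\<And>x. x > a \<Longrightarrow> coeff_of f x = 0"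
    using puiseux_posE[OF assms(1)] by metis
  obtain b where b: "coeff_of g b > 0" "\<And>x. x > b \<Longrightarrow> coeff_of g x = 0"
    using puiseux_posE[OF assms(2)] by metis
  show ?thesis
  proof (rule puiseux_posI[of _ "max a b"])
    show "coeff_of (f + g) (max a b) > 0"
      using a b by (cases a b rule: linorder_cases) (auto simp: max_def)
  qed (use a b in auto)
qed

lemma puiseux_pos_mult:
  assumes "puiseux_pos f" "puiseux_pos g"
  shows "puiseux_pos (f * g)"
proof -
  obtain a where a: "coeff_of f a > 0" "\<And>x. x > a \<Longrightarrow> coeff_of f x = 0"
    using puiseux_posE[OF assms(1)] by metis
  obtain b where b: "coeff_of g b > 0" "\<And>x. x > b \<Longrightarrow> coeff_of g x = 0"
    using puiseux_posE[OF assms(2)] by metis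
  show ?thesis
    by (rule puiseux_posI[of _ "a + b"])
      (use a b coeff_mult_top[of a f b g] in auto)
qed

lemma puiseux_pos_cases: "f = 0 \<or> puiseux_pos f \<or> puiseux_pos (- f)"
proof (cases "f = 0")
  case False
  then have "coeff_of f (lead_exp f) > 0 \<or> coeff_of (- f) (lead_exp f) > 0"
    using coeff_lead_exp by fastforce
  then show ?thesis
    using puiseux_posI[of f "lead_exp f"] puiseux_posI[of "- f" "lead_exp f"]
      coeff_above_lead_exp[OF False] by auto
qed simp

lemma not_puiseux_pos_0: "\<not> puiseux_pos 0"
  by (simp add: puiseux_pos_def)

instantiation puiseux :: linordered_field
begin

definition less_puiseux :: "puiseux \<Rightarrow> puiseux \<Rightarrow> bool" where
  "f < g \<longleftrightarrow> puiseux_pos (g - f)" for f g :: puiseux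

definition less_eq_puiseux :: "puiseux \<Rightarrow> puiseux \<Rightarrow> bool" where
  "f \<le> g \<longleftrightarrow> f = g \<or> f < g" for f g :: puiseux

definition abs_puiseux :: "puiseux \<Rightarrow> puiseux" where
  "\<bar>f\<bar> = (if f < 0 then - f else f)" for f :: puiseux

definition sgn_puiseux :: "puiseux \<Rightarrow> puiseux" where
  "sgn f = (if f = 0 then 0 else if 0 < f then 1 else - 1)" for f :: puiseux

instance
proof
  fix x y z :: puiseux
  have asym: "\<not> (puiseux_pos f \<and> puiseux_pos (- f))" for f
    using puiseux_pos_add[of f "- f"] not_puiseux_pos_0 by auto
  show "x < y \<longleftrightarrow> x \<le> y \<and> \<not> y \<le> x"
    unfolding less_eq_puiseux_def less_puiseux_def
    using asym[of "x - y"] not_puiseux_pos_0 by auto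
  show "x \<le> x" by (simp add: less_eq_puiseux_def)
  show "x \<le> z" if "x \<le> y" "y \<le> z"
    using that puiseux_pos_add[of "y - x" "z - y"]
    by (auto simp: less_eq_puiseux_def less_puiseux_def)
  show "x = y" if "x \<le> y" "y \<le> x"
    using that asym[of "x - y"] by (auto simp: less_eq_puiseux_def less_puiseux_def)
  show "x \<le> y \<or> y \<le> x"
    using puiseux_pos_cases[of "x - y"] by (auto simp: less_eq_puiseux_def less_puiseux_def)
  show "z + x \<le> z + y" if "x \<le> y"
    using that by (auto simp: less_eq_puiseux_def less_puiseux_def)
  show "z * x < z * y" if "x < y" "0 < z"
    using that puiseux_pos_mult[of z "y - x"]
    by (auto simp: less_puiseux_def right_diff_distrib)
qed (simp_all add: abs_puiseux_def sgn_puiseux_def)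
end

section \<open>The max-plus semiring\<close>

datatype rmax = MInf | Fin real

instantiation rmax :: linorder
begin

fun less_eq_rmax :: "rmax \<Rightarrow> rmax \<Rightarrow> bool" where
  "MInf \<le> y \<longleftrightarrow> True"
| "Fin a \<le> MInf \<longleftrightarrow> False"
| "Fin a \<le> Fin b \<longleftrightarrow> a \<le> b"

definition less_rmax :: "rmax \<Rightarrow> rmax \<Rightarrow> bool" where
  "x < y \<longleftrightarrow> x \<le> y \<and> \<not> y \<le> x" for x y :: rmax

instance
proof
  fix x y z :: rmax
  show "x < y \<longleftrightarrow> x \<le> y \<and> \<not> y \<le> x" by (rule less_rmax_def)
  show "x \<le> x" by (cases x) auto
  show "x \<le> y \<Longrightarrow> y \<le> z \<Longrightarrow> x \<le> z" by (cases x; cases y; cases z) auto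
  show "x \<le> y \<Longrightarrow> y \<le> x \<Longrightarrow> x = y" by (cases x; cases y) auto
  show "x \<le> y \<or> y \<le> x" by (cases x; cases y) auto
qed
end

instantiation rmax :: comm_semiring_1
begin

definition plus_rmax :: "rmax \<Rightarrow> rmax \<Rightarrow> rmax" where
  "x + y = max x y" for x y :: rmax

fun times_rmax :: "rmax \<Rightarrow> rmax \<Rightarrow> rmax" where
  "Fin a * Fin b = Fin (a + b)"
| "MInf * y = MInf"
| "x * MInf = MInf"

definition zero_rmax :: rmax where "0 = MInf"

definition one_rmax :: rmax where "1 = Fin 0"

instance
proof
  fix a b c :: rmax
  show "a + b + c = a + (b + c)" by (simp add: plus_rmax_def max.assoc)
  show "a + b = b + a" by (simp add: plus_rmax_def max.commute)
  show "0 + a = a" by (simp add: plus_rmax_def zero_rmax_def max_def)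
  show "a * b * c = a * (b * c)" by (cases a; cases b; cases c) auto
  show "a * b = b * a" by (cases a; cases b) auto
  show "1 * a = a" by (cases a) (auto simp: one_rmax_def)
  show "(a + b) * c = a * c + b * c"
    by (cases a; cases b; cases c) (auto simp: plus_rmax_def max_def)
  show "0 * a = 0" "a * 0 = 0" by (cases a; simp add: zero_rmax_def)+
  show "(0 :: rmax) \<noteq> 1" by (simp add: zero_rmax_def one_rmax_def)
qed
end

text \<open>\<^typ>\<open>rmax\<close> is a semiring in which \<^term>\<open>x + y :: rmax\<close> is the maximum,
  \<^term>\<open>x * y :: rmax\<close> is the sum of extended reals, \<^term>\<open>0 :: rmax\<close> is $-\infty$ and
  \<^term>\<open>1 :: rmax\<close> is the real number zero. Products and identities of
  matrices over \<^typ>\<open>rmax\<close> are therefore the tropical ones.\<close>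

definition val :: "puiseux \<Rightarrow> rmax" where
  "val f = (if f = 0 then MInf else Fin (lead_exp f))"

abbreviation val_mat :: "puiseux mat \<Rightarrow> rmax mat" where
  "val_mat \<equiv> map_mat val"

section \<open>Classes of matrices\<close>

definition square_submatrices :: "'a mat \<Rightarrow> 'a mat set" where
  "square_submatrices A =
     {submatrix A I J | I J. I \<subseteq> {..<dim_row A} \<and> J \<subseteq> {..<dim_col A} \<and> card I = card J \<and> card I > 0}"

subsection \<open>Matrices over the Puiseux series\<close>

definition TP :: "nat \<Rightarrow> nat \<Rightarrow> puiseux mat set" where
  "TP n m = {A \<in> carrier_mat n m. \<forall>B \<in> square_submatrices A. det B > 0}"

definition TN :: "nat \<Rightarrow> nat \<Rightarrow> puiseux mat set" where
  "TN n m = {A \<in> carrier_mat n m. \<forall>B \<in> square_submatrices A. det B \<ge> 0}"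

definition TN_nonzero :: "nat \<Rightarrow> nat \<Rightarrow> puiseux mat set" where
  "TN_nonzero n m = {A \<in> TN n m. \<forall>i<n. \<forall>j<m. A $$ (i, j) \<noteq> 0}"

definition GL :: "nat \<Rightarrow> puiseux mat set" where
  "GL n = {A \<in> carrier_mat n n. invertible_mat A}"

subsection \<open>Tropical matrices\<close>

text \<open>The product below is that of \<^typ>\<open>rmax\<close>, i.e.\ a sum of entries.\<close>

definition weight :: "rmax mat \<Rightarrow> (nat \<Rightarrow> nat) \<Rightarrow> rmax" where
  "weight M \<sigma> = (\<Prod>i = 0..<dim_row M. M $$ (i, \<sigma> i))"

definition per :: "rmax mat \<Rightarrow> rmax" where
  "per M = Max (weight M ` {\<sigma>. \<sigma> permutes {0..<dim_row M}})"

definition max_perms :: "rmax mat \<Rightarrow> (nat \<Rightarrow> nat) set" where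
  "max_perms M = {\<sigma>. \<sigma> permutes {0..<dim_row M} \<and> weight M \<sigma> = per M}"

definition sign_nonsingular :: "rmax mat \<Rightarrow> bool" where
  "sign_nonsingular M \<longleftrightarrow>
     per M \<noteq> MInf \<and> (\<forall>\<sigma> \<in> max_perms M. \<forall>\<tau> \<in> max_perms M. evenperm \<sigma> \<longleftrightarrow> evenperm \<tau>)"

definition trop_positive :: "rmax mat \<Rightarrow> bool" where
  "trop_positive M \<longleftrightarrow> per M \<noteq> MInf \<and> (\<forall>\<sigma> \<in> max_perms M. evenperm \<sigma>)"

definition trop_nonneg :: "rmax mat \<Rightarrow> bool" where
  "trop_nonneg M \<longleftrightarrow> trop_positive M \<or> \<not> sign_nonsingular M"

definition real_mats :: "nat \<Rightarrow> nat \<Rightarrow> rmax mat set" where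
  "real_mats n m = map_mat Fin ` carrier_mat n m"

definition TPtrop :: "nat \<Rightarrow> nat \<Rightarrow> rmax mat set" where
  "TPtrop n m = {A \<in> real_mats n m. \<forall>B \<in> square_submatrices A. trop_positive B}"

definition TNtrop :: "nat \<Rightarrow> nat \<Rightarrow> rmax mat set" where
  "TNtrop n m = {A \<in> carrier_mat n m. \<forall>B \<in> square_submatrices A. trop_nonneg B}"

definition TNtrop_real :: "nat \<Rightarrow> nat \<Rightarrow> rmax mat set" where
  "TNtrop_real n m = TNtrop n m \<inter> real_mats n m"

definition TPtrop2 :: "nat \<Rightarrow> nat \<Rightarrow> rmax mat set" where
  "TPtrop2 n m = {A \<in> carrier_mat n m. \<forall>B \<in> square_submatrices A. dim_row B \<le> 2 \<longrightarrow> trop_positive B}"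

definition TNtrop2 :: "nat \<Rightarrow> nat \<Rightarrow> rmax mat set" where
  "TNtrop2 n m = {A \<in> carrier_mat n m. \<forall>B \<in> square_submatrices A. dim_row B \<le> 2 \<longrightarrow> trop_nonneg B}"

definition trop_diag_dominant :: "rmax mat \<Rightarrow> bool" where
  "trop_diag_dominant M \<longleftrightarrow> per M = weight M id"

definition trop_strictly_diag_dominant :: "rmax mat \<Rightarrow> bool" where
  "trop_strictly_diag_dominant M \<longleftrightarrow>
     (\<forall>\<sigma>. \<sigma> permutes {0..<dim_row M} \<and> \<sigma> \<noteq> id \<longrightarrow> per M > weight M \<sigma>)"

definition DDtrop :: "nat \<Rightarrow> nat \<Rightarrow> rmax mat set" where
  "DDtrop n m = {A \<in> carrier_mat n m. \<forall>B \<in> square_submatrices A. trop_diag_dominant B}"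

definition SDDtrop :: "nat \<Rightarrow> nat \<Rightarrow> rmax mat set" where
  "SDDtrop n m = {A \<in> carrier_mat n m. \<forall>B \<in> square_submatrices A. trop_strictly_diag_dominant B}"

text \<open>The following inclusion is immediate from the definitions. Hence an inclusion of
  \<^term>\<open>TNtrop2 n m\<close> in \<^term>\<open>DDtrop n m\<close> is never strict.\<close>

lemma DDtrop_subset_TNtrop: "DDtrop n m \<subseteq> TNtrop n m"
proof -
  have "trop_nonneg B" if "trop_diag_dominant B" for B
  proof (cases "sign_nonsingular B")
    case True
    have "id \<in> max_perms B"
      using that by (simp add: max_perms_def trop_diag_dominant_def permutes_id)
    then have "evenperm \<sigma>" if "\<sigma> \<in> max_perms B" for \<sigma>
      using True that evenperm_id unfolding sign_nonsingular_def by blast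
    then show ?thesis using True by (simp add: trop_nonneg_def trop_positive_def sign_nonsingular_def)
  qed (simp add: trop_nonneg_def)
  then show ?thesis by (auto simp: DDtrop_def TNtrop_def)
qed

lemma DDtrop_subset_TNtrop2: "DDtrop n m \<subseteq> TNtrop2 n m"
  using DDtrop_subset_TNtrop[of n m] by (auto simp: TNtrop_def TNtrop2_def)

subsection \<open>Monge and staircase matrices\<close>

definition monge :: "real mat \<Rightarrow> bool" where
  "monge A \<longleftrightarrow> (\<forall>i i' j j'. i < i' \<and> i' < dim_row A \<and> j < j' \<and> j' < dim_col A \<longrightarrow>
     A $$ (i, j) + A $$ (i', j') \<ge> A $$ (i, j') + A $$ (i', j))"

definition strict_monge :: "real mat \<Rightarrow> bool" where
  "strict_monge A \<longleftrightarrow> (\<forall>i i' j j'. i < i' \<and> i' < dim_row A \<and> j < j' \<and> j' < dim_col A \<longrightarrow>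
     A $$ (i, j) + A $$ (i', j') > A $$ (i, j') + A $$ (i', j))"

text \<open>Indices start at 0, so the elementary staircase matrices are those with
  \<^term>\<open>1 \<le> i \<and> i < n\<close> and \<^term>\<open>1 \<le> j \<and> j < m\<close>.\<close>

definition elem_staircase :: "nat \<Rightarrow> nat \<Rightarrow> nat \<Rightarrow> nat \<Rightarrow> real mat" where
  "elem_staircase n m i j = mat n m (\<lambda>(t, s). if i \<le> t \<and> j \<le> s then 1 else 0)"

definition staircase_mats :: "nat \<Rightarrow> nat \<Rightarrow> real mat set" where
  "staircase_mats n m =
     {mat n m (\<lambda>(t, s). \<Sum>i = 1..<n. \<Sum>j = 1..<m. c i j * elem_staircase n m i j $$ (t, s)) | c.
       \<forall>i j. c i j \<ge> 0}"

definition scaled_staircase_mats :: "nat \<Rightarrow> nat \<Rightarrow> real mat set" where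
  "scaled_staircase_mats n m =
     {mat n m (\<lambda>(i, j). S $$ (i, j) + u $ i + v $ j) | S u v.
       S \<in> staircase_mats n m \<and> u \<in> carrier_vec n \<and> v \<in> carrier_vec m}"

subsection \<open>Tropical Jacobi matrices\<close>

definition jacobi_mats :: "nat \<Rightarrow> rmax mat set" where
  "jacobi_mats n = {A \<in> carrier_mat n n.
     card {(i, j). i < n \<and> j < n \<and> A $$ (i, j) \<noteq> 1\<^sub>m n $$ (i, j)} \<le> 1 \<and>
     (\<forall>i<n. \<forall>j<n. A $$ (i, j) \<noteq> 1\<^sub>m n $$ (i, j) \<longrightarrow>
        A $$ (i, j) \<noteq> MInf \<and> (i = j \<or> j = Suc i \<or> i = Suc j))}"

inductive_set mat_semigroup :: "rmax mat set \<Rightarrow> rmax mat set" for X :: "rmax mat set" where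
  gen: "A \<in> X \<Longrightarrow> A \<in> mat_semigroup X"
| mult: "A \<in> mat_semigroup X \<Longrightarrow> B \<in> mat_semigroup X \<Longrightarrow> A * B \<in> mat_semigroup X"

end

theory Submission
  imports Defs
begin

text \<open>
  All classes are governed by the Monge inequalities \<open>a i j' * a i' j \<le> a i j * a i' j'\<close> for \<open>i < i'\<close>
  and \<open>j < j'\<close>, where the product is that of the max-plus semiring and entries may be $-\infty$.

  These inequalities say that the tropical minors of size two are nonnegative. Any permutation is
  brought to the identity by swaps that undo an inversion, and by the inequality for the two rows and
  the two columns concerned no swap lowers the weight. Hence the diagonal is of maximal weight in every
  square submatrix, which gives \<open>TNtrop = TNtrop2 = DDtrop\<close> (\<open>TNtrop_eq\<close>). With strict inequalities
  and finite entries the identity is the only maximal permutation, which gives \<open>TPtrop = TPtrop2\<close> and the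
  strict Monge matrices (\<open>TPtrop_eq\<close>).

  Valuations of totally nonnegative matrices satisfy the Monge inequalities because their minors of
  size two are nonnegative. Conversely, a matrix with these inequalities is lifted to the
  matrix with entries \<open>N ^ (i * j) * t ^ A i j\<close>, where \<open>N = n!\<close>. The real matrix \<open>N ^ (i * j)\<close> turns the weak
  inequalities into \<open>N * (a i j' * a i' j) \<le> a i j * a i' j'\<close> over the field of series. The same
  sorting argument now shows that in a minor every other term of the Leibniz formula is at most
  \<open>1 / N\<close> times the diagonal term, so that the terms cannot cancel the diagonal (\<open>lift_mat_minor\<close>).
  Every minor of the lift is therefore nonnegative, and it is positive if its diagonal is finite. This single lift
  serves \<open>TN\<close>, \<open>TP\<close> (all entries finite) and the nonsingular matrices (finite diagonal), see
  \<open>val_TN_eq\<close>, \<open>val_TP_eq\<close> and \<open>val_GL_TN_eq\<close>.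

  Real Monge matrices are scaled staircase matrices because the Monge inequalities on consecutive rows
  and columns say that the second differences are nonnegative (\<open>monge_eq_scaled_staircase\<close>).

  For products of Jacobi matrices, the Monge inequalities and a finite diagonal are preserved by tropical
  products. Conversely such a matrix is factored by a tropical form of Neville elimination. Unlike over a
  field, clearing an entry below the diagonal changes nothing else: the lowest finite entry in the
  leftmost column that is not yet cleared is replaced by $-\infty$, and a multiple of the row above
  restores it without exceeding the remaining entries of its row (\<open>split_off_lower\<close>).

  The strict inclusions are witnessed by the zero and identity matrices of the max-plus semiring, by the
  real matrix whose entries all vanish, and by a strict Monge matrix whose upper right entry is replaced
  by $-\infty$.
\<close>

section \<open>Sorting a permutation by swaps\<close>

lemma increasing_permutes_id:
  fixes k :: nat
  assumes "\<sigma> permutes {0..<k}" and "\<And>i j. i < j \<Longrightarrow> j < k \<Longrightarrow> \<sigma> i < \<sigma> j"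
  shows "\<sigma> = (id :: nat \<Rightarrow> nat)"
proof -
  have "i \<le> \<sigma> i" if "i < k" for i
    using that
  proof (induction i)
    case (Suc i)
    then show ?case using assms(2)[of i "Suc i"] by simp
  qed simp
  then show ?thesis using permutes_natset_ge[OF assms(1)] by simp
qed

lemma prod_split_two:
  fixes g :: "'b \<Rightarrow> 'a :: comm_monoid_mult"
  assumes "finite A" "i \<in> A" "j \<in> A" "i \<noteq> j"
  shows "prod g A = g i * g j * prod g (A - {i, j})"
proof -
  have "prod g A = g i * prod g (A - {i})" using assms by (simp add: prod.remove)
  also have "prod g (A - {i}) = g j * prod g (A - {i} - {j})" using assms by (intro prod.remove) auto
  also have "A - {i} - {j} = A - {i, j}" by auto
  finally show ?thesis by (simp add: mult.assoc)
qed

lemma prod_swap: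
  fixes f :: "nat \<Rightarrow> nat \<Rightarrow> 'a :: comm_monoid_mult"
  assumes "i < j" "j < k"
  obtains r where "(\<Prod>l = 0..<k. f l (\<sigma> l)) = f i (\<sigma> i) * f j (\<sigma> j) * r"
    and "(\<Prod>l = 0..<k. f l ((\<sigma> \<circ> transpose i j) l)) = f i (\<sigma> j) * f j (\<sigma> i) * r"
    and "r = (\<Prod>l\<in>{0..<k} - {i, j}. f l (\<sigma> l))"
proof
  let ?r = "\<Prod>l\<in>{0..<k} - {i, j}. f l (\<sigma> l)"
  show "(\<Prod>l = 0..<k. f l (\<sigma> l)) = f i (\<sigma> i) * f j (\<sigma> j) * ?r"
    using assms by (subst prod_split_two[of _ i j]) auto
  have "(\<Prod>l\<in>{0..<k} - {i, j}. f l ((\<sigma> \<circ> transpose i j) l)) = ?r"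
    by (rule prod.cong) (auto simp: transpose_apply_other)
  then show "(\<Prod>l = 0..<k. f l ((\<sigma> \<circ> transpose i j) l)) = f i (\<sigma> j) * f j (\<sigma> i) * ?r"
    using assms by (subst prod_split_two[of _ i j]) auto
qed (rule refl)

text \<open>Every permutation other than the identity has an inversion, and undoing an inversion lowers
  \<open>\<Sum>l = 0..<k. (k - l) * \<sigma> l\<close>, so that finitely many such swaps lead to the identity.\<close>

lemma permutes_sort_induct [consumes 1, case_names id swap]:
  fixes k :: nat
  assumes "\<sigma> permutes {0..<k}" and "P id"
    and swap: "\<And>\<sigma> i j. \<sigma> permutes {0..<k} \<Longrightarrow> i < j \<Longrightarrow> j < k \<Longrightarrow> \<sigma> j < \<sigma> i \<Longrightarrow>
      P (\<sigma> \<circ> transpose i j) \<Longrightarrow> P \<sigma>"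
  shows "P \<sigma>"
  using assms(1)
proof (induction "\<Sum>l = 0..<k. (k - l) * \<sigma> l" arbitrary: \<sigma> rule: less_induct)
  case less
  show ?case
  proof (cases "\<exists>i j. i < j \<and> j < k \<and> \<sigma> j < \<sigma> i")
    case False
    have "\<sigma> i < \<sigma> j" if "i < j" "j < k" for i j
    proof -
      have "\<sigma> i \<noteq> \<sigma> j" using that inj_eq[OF permutes_inj[OF less.prems], of i j] by simp
      moreover have "\<not> \<sigma> j < \<sigma> i" using False that by blast
      ultimately show ?thesis by simp
    qed
    then have "\<sigma> = id" using less.prems by (intro increasing_permutes_id) auto
    then show ?thesis using assms(2) by simp
  next
    case True
    then obtain i j where ij: "i < j" "j < k" "\<sigma> j < \<sigma> i" by blast
    let ?\<tau> = "\<sigma> \<circ> transpose i j"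
    have \<tau>: "?\<tau> permutes {0..<k}"
      using ij less.prems by (intro permutes_compose permutes_swap_id) auto
    let ?s = "\<Sum>l\<in>{0..<k} - {i, j}. (k - l) * \<sigma> l"
    have split: "sum g {0..<k} = g i + g j + sum g ({0..<k} - {i, j})" for g :: "nat \<Rightarrow> nat"
    proof -
      have "sum g {0..<k} = sum g ({0..<k} - {i, j}) + sum g {i, j}"
        by (rule sum.subset_diff) (use ij in auto)
      then show ?thesis using ij by simp
    qed
    have "(\<Sum>l\<in>{0..<k} - {i, j}. (k - l) * ?\<tau> l) = ?s"
      by (rule sum.cong) (auto simp: transpose_apply_other)
    moreover have "(k - i) * \<sigma> j + (k - j) * \<sigma> i < (k - i) * \<sigma> i + (k - j) * \<sigma> j"
    proof -
      define d where "d = \<sigma> i - \<sigma> j"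
      have d: "\<sigma> i = \<sigma> j + d" "d > 0" using ij(3) by (auto simp: d_def)
      define e where "e = j - i"
      have e: "k - i = k - j + e" "e > 0" using ij by (auto simp: e_def)
      show ?thesis unfolding d(1) e(1) using d(2) e(2) by (simp add: algebra_simps)
    qed
    ultimately have "(\<Sum>l = 0..<k. (k - l) * ?\<tau> l) < (\<Sum>l = 0..<k. (k - l) * \<sigma> l)"
      unfolding split[of "\<lambda>l. (k - l) * ?\<tau> l"] split[of "\<lambda>l. (k - l) * \<sigma> l"] by simp
    then show ?thesis using less.hyps \<tau> swap[OF less.prems ij] by blast
  qed
qed

section \<open>Multiplicative Monge inequalities\<close>

text \<open>The same inequality on the minors of size two serves over the max-plus semiring, where
  \<open>c\<close> is the unit and it is the Monge property, and over an ordered field, where a large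
  \<open>c\<close> makes the diagonal outweigh the other permutations together.\<close>

definition mult_monge :: "'a :: {times, ord} \<Rightarrow> nat \<Rightarrow> nat \<Rightarrow> (nat \<Rightarrow> nat \<Rightarrow> 'a) \<Rightarrow> bool" where
  "mult_monge c n m f \<longleftrightarrow> (\<forall>i i' j j'. i < i' \<and> i' < n \<and> j < j' \<and> j' < m \<longrightarrow>
     c * (f i j' * f i' j) \<le> f i j * f i' j')"

definition strict_mult_monge :: "nat \<Rightarrow> nat \<Rightarrow> (nat \<Rightarrow> nat \<Rightarrow> 'a :: {times, ord}) \<Rightarrow> bool" where
  "strict_mult_monge n m f \<longleftrightarrow> (\<forall>i i' j j'. i < i' \<and> i' < n \<and> j < j' \<and> j' < m \<longrightarrow>
     f i j' * f i' j < f i j * f i' j')"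

lemma mult_mongeD:
  "mult_monge c n m f \<Longrightarrow> i < i' \<Longrightarrow> i' < n \<Longrightarrow> j < j' \<Longrightarrow> j' < m \<Longrightarrow>
    c * (f i j' * f i' j) \<le> f i j * f i' j'"
  by (simp add: mult_monge_def)

lemma strict_mult_mongeD:
  "strict_mult_monge n m f \<Longrightarrow> i < i' \<Longrightarrow> i' < n \<Longrightarrow> j < j' \<Longrightarrow> j' < m \<Longrightarrow>
    f i j' * f i' j < f i j * f i' j'"
  by (simp add: strict_mult_monge_def)

lemma mult_monge_subindices:
  assumes "mult_monge c n m f"
    and "strict_mono_on {..<k} r" "strict_mono_on {..<l} s"
    and "\<And>i. i < k \<Longrightarrow> r i < n" "\<And>j. j < l \<Longrightarrow> s j < m"
  shows "mult_monge c k l (\<lambda>i j. f (r i) (s j))"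
  unfolding mult_monge_def
proof (intro allI impI)
  fix i i' j j' assume *: "i < i' \<and> i' < k \<and> j < j' \<and> j' < l"
  then have "r i < r i'" "s j < s j'" 
    using strict_mono_onD[OF assms(2), of i i'] strict_mono_onD[OF assms(3), of j j'] by auto
  then show "c * (f (r i) (s j') * f (r i') (s j)) \<le> f (r i) (s j) * f (r i') (s j')"
    using assms(1,4,5) * by (intro mult_mongeD) auto
qed

lemma strict_mult_monge_subindices:
  assumes "strict_mult_monge n m f"
    and "strict_mono_on {..<k} r" "strict_mono_on {..<l} s"
    and "\<And>i. i < k \<Longrightarrow> r i < n" "\<And>j. j < l \<Longrightarrow> s j < m"
  shows "strict_mult_monge k l (\<lambda>i j. f (r i) (s j))"
  unfolding strict_mult_monge_def
proof (intro allI impI)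
  fix i i' j j' assume *: "i < i' \<and> i' < k \<and> j < j' \<and> j' < l"
  then have "r i < r i'" "s j < s j'" 
    using strict_mono_onD[OF assms(2), of i i'] strict_mono_onD[OF assms(3), of j j'] by auto
  then show "f (r i) (s j') * f (r i') (s j) < f (r i) (s j) * f (r i') (s j')"
    using assms(1,4,5) * by (intro strict_mult_mongeD) auto
qed

text \<open>Each swap that undoes an inversion gains the factor \<open>c\<close>, and a permutation other than the
  identity needs at least one.\<close>

lemma mult_monge_prod_le:
  fixes f :: "nat \<Rightarrow> nat \<Rightarrow> 'a :: {ordered_semiring_1, comm_semiring_1}"
  assumes f: "mult_monge c k k f" "\<And>i j. i < k \<Longrightarrow> j < k \<Longrightarrow> 0 \<le> f i j" and c: "1 \<le> c"
    and \<sigma>: "\<sigma> permutes {0..<k}"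
  shows "\<sigma> \<noteq> id \<Longrightarrow> c * (\<Prod>l = 0..<k. f l (\<sigma> l)) \<le> (\<Prod>l = 0..<k. f l l)"
    and "(\<Prod>l = 0..<k. f l (\<sigma> l)) \<le> (\<Prod>l = 0..<k. f l l)"
proof -
  have nonneg: "0 \<le> (\<Prod>l\<in>A. f l (\<rho> l))" if "\<rho> permutes {0..<k}" "A \<subseteq> {0..<k}" for \<rho> A
    using finite_subset[OF that(2) finite_atLeastLessThan] that(2)
  proof (induction A rule: finite_induct)
    case (insert x A)
    have "x < k" "\<rho> x < k" using insert.prems permutes_in_image[OF that(1), of x] by auto
    then show ?case using insert f(2) by simp
  qed simp
  have grow: "p \<le> c * p" if "0 \<le> p" for p :: 'a
    using mult_right_mono[OF c that] by simp
  have "\<sigma> \<noteq> id \<longrightarrow> c * (\<Prod>l = 0..<k. f l (\<sigma> l)) \<le> (\<Prod>l = 0..<k. f l l)"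
    using \<sigma>
  proof (induction rule: permutes_sort_induct)
    case (swap \<sigma> i j)
    let ?\<tau> = "\<sigma> \<circ> transpose i j"
    obtain r where r: "(\<Prod>l = 0..<k. f l (\<sigma> l)) = f i (\<sigma> i) * f j (\<sigma> j) * r"
      "(\<Prod>l = 0..<k. f l (?\<tau> l)) = f i (\<sigma> j) * f j (\<sigma> i) * r"
      "r = (\<Prod>l\<in>{0..<k} - {i, j}. f l (\<sigma> l))"
      by (rule prod_swap[OF swap(2,3), of f \<sigma>])
    have "\<sigma> i < k" using permutes_in_image[OF swap(1), of i] swap(2,3) by auto
    then have gain: "c * (f i (\<sigma> i) * f j (\<sigma> j)) \<le> f i (\<sigma> j) * f j (\<sigma> i)"
      using mult_mongeD[OF f(1) swap(2,3,4)] by simp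
    have r0: "0 \<le> r" unfolding r(3) by (rule nonneg) (use swap in auto)
    have step: "c * (\<Prod>l = 0..<k. f l (\<sigma> l)) \<le> (\<Prod>l = 0..<k. f l (?\<tau> l))"
      using mult_right_mono[OF gain r0] unfolding r(1,2) by (simp add: mult.assoc)
    have \<tau>: "?\<tau> permutes {0..<k}"
      using swap(1-3) by (intro permutes_compose permutes_swap_id) auto
    show ?case
    proof (cases "?\<tau> = id")
      case True
      then show ?thesis using step by simp
    next
      case False
      note step
      also have "(\<Prod>l = 0..<k. f l (?\<tau> l)) \<le> c * (\<Prod>l = 0..<k. f l (?\<tau> l))"
        by (intro grow nonneg[OF \<tau>]) simp
      also have "\<dots> \<le> (\<Prod>l = 0..<k. f l l)" using False swap.IH by blast
      finally show ?thesis by simp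
    qed
  qed simp
  then show *: "\<sigma> \<noteq> id \<Longrightarrow> c * (\<Prod>l = 0..<k. f l (\<sigma> l)) \<le> (\<Prod>l = 0..<k. f l l)" by simp
  show "(\<Prod>l = 0..<k. f l (\<sigma> l)) \<le> (\<Prod>l = 0..<k. f l l)"
    using * grow nonneg[OF \<sigma>, of "{0..<k}"] by (cases "\<sigma> = id") (auto intro: order_trans)
qed

text \<open>With \<open>c \<ge> k!\<close>, the fewer than \<open>k!\<close> terms of the Leibniz formula that come with a
  permutation other than the identity each have at most \<open>1 / k!\<close> of the size of the diagonal
  term. At least that fraction of the diagonal term therefore survives in the determinant, whatever
  the signs.\<close>

lemma diag_prod_le_fact_det:
  fixes A :: "'a :: linordered_idom mat"
  assumes A: "A \<in> carrier_mat k k" "\<And>i j. i < k \<Longrightarrow> j < k \<Longrightarrow> 0 \<le> A $$ (i, j)"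
    and monge: "mult_monge c k k (\<lambda>i j. A $$ (i, j))" and c: "fact k \<le> c"
  shows "(\<Prod>i = 0..<k. A $$ (i, i)) \<le> fact k * det A"
proof -
  let ?S = "{\<sigma>. \<sigma> permutes {0..<k}}"
  let ?w = "\<lambda>\<sigma>. \<Prod>i = 0..<k. A $$ (i, \<sigma> i)"
  have fin: "finite ?S" and card: "card ?S = fact k" by (auto simp: finite_permutations card_permutations)
  have id: "id \<in> ?S" by (simp add: permutes_id)
  have c1: "1 \<le> c" using order_trans[OF fact_ge_1 c] .
  have w: "fact k * ?w \<sigma> \<le> ?w id" and w0: "0 \<le> ?w \<sigma>" if "\<sigma> \<in> ?S - {id}" for \<sigma>
  proof -
    show "0 \<le> ?w \<sigma>" using that A(2) permutes_in_image[of \<sigma> "{0..<k}"] by (intro prod_nonneg) auto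
    then have "fact k * ?w \<sigma> \<le> c * ?w \<sigma>" using c by (intro mult_right_mono)
    also have "\<dots> \<le> ?w id" using mult_monge_prod_le(1)[OF monge A(2) c1, of \<sigma>] that by simp
    finally show "fact k * ?w \<sigma> \<le> ?w id" .
  qed
  have "fact k * ?w id - (fact k - 1) * ?w id \<le>
      fact k * ?w id - (\<Sum>\<sigma>\<in>?S - {id}. fact k * ?w \<sigma>)"
  proof -
    have "(\<Sum>\<sigma>\<in>?S - {id}. fact k * ?w \<sigma>) \<le> of_nat (card (?S - {id})) * ?w id"
      using w by (intro sum_bounded_above) auto
    also have "of_nat (card (?S - {id})) = (fact k - 1 :: 'a)"
      using id card fin by (simp add: card_Diff_singleton of_nat_diff)
    finally show ?thesis by (rule diff_left_mono)
  qed
  also have "\<dots> \<le> fact k * ?w id + (\<Sum>\<sigma>\<in>?S - {id}. fact k * (signof \<sigma> * ?w \<sigma>))"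
  proof -
    have "- (fact k * ?w \<sigma>) \<le> fact k * (signof \<sigma> * ?w \<sigma>)" if "\<sigma> \<in> ?S - {id}" for \<sigma>
    proof -
      have "- ?w \<sigma> \<le> signof \<sigma> * ?w \<sigma>" using w0[OF that] by (auto simp: sign_def)
      from mult_left_mono[OF this, of "fact k"] show ?thesis by simp
    qed
    then have "(\<Sum>\<sigma>\<in>?S - {id}. - (fact k * ?w \<sigma>)) \<le>
        (\<Sum>\<sigma>\<in>?S - {id}. fact k * (signof \<sigma> * ?w \<sigma>))"
      by (intro sum_mono)
    then show ?thesis by (simp add: sum_negf)
  qed
  also have "\<dots> = fact k * (\<Sum>\<sigma>\<in>?S. signof \<sigma> * ?w \<sigma>)"
    using sum.remove[OF fin id, of "\<lambda>\<sigma>. signof \<sigma> * ?w \<sigma>"]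
    by (simp add: sum_distrib_left distrib_left)
  also have "\<dots> = fact k * det A" using det_def'[OF A(1)] by simp
  finally show ?thesis by (simp add: algebra_simps)
qed

section \<open>The order of the max-plus semiring\<close>

instance rmax :: ordered_semiring_1
proof
  fix a b c :: rmax
  show "a \<le> b \<Longrightarrow> c + a \<le> c + b" by (auto simp: plus_rmax_def max_def)
  show "a \<le> b \<Longrightarrow> c * a \<le> c * b" by (cases a; cases b; cases c) auto
  show "a \<le> b \<Longrightarrow> a * c \<le> b * c" by (cases a; cases b; cases c) auto
  show "(0 :: rmax) < 1" by (simp add: less_rmax_def zero_rmax_def one_rmax_def)
qed

lemma rmax_zero_le [simp]: "0 \<le> (x :: rmax)"
  by (simp add: zero_rmax_def)

lemma MInf_less_iff [simp]: "MInf < x \<longleftrightarrow> x \<noteq> MInf"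
  by (cases x) (auto simp: less_rmax_def)

lemma Fin_less_iff [simp]: "Fin a < Fin b \<longleftrightarrow> a < b"
  by (auto simp: less_rmax_def)

lemma times_MInf_right [simp]: "x * MInf = MInf"
  by (cases x) auto

lemma times_eq_MInf_iff: "x * y = MInf \<longleftrightarrow> x = MInf \<or> y = MInf"
  by (cases x; cases y) auto

lemma prod_eq_MInf_iff:
  fixes g :: "'a \<Rightarrow> rmax"
  shows "finite S \<Longrightarrow> prod g S = MInf \<longleftrightarrow> (\<exists>x\<in>S. g x = MInf)"
  by (induction S rule: finite_induct) (auto simp: times_eq_MInf_iff one_rmax_def)

lemma rmax_mult_strict_right_mono: "x < y \<Longrightarrow> r \<noteq> MInf \<Longrightarrow> x * r < y * (r :: rmax)"
  by (cases x; cases y; cases r) (auto simp: less_rmax_def)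

lemma rmax_mult_mono: "x \<le> y \<Longrightarrow> z \<le> w \<Longrightarrow> x * z \<le> y * (w :: rmax)"
  by (cases x; cases y; cases z; cases w) auto

section \<open>Square submatrices\<close>

text \<open>A submatrix amounts to two increasing choices of indices, which is the form in which
  inequalities on pairs of rows and columns are inherited.\<close>

lemma submatrix_strict_mono:
  assumes A: "A \<in> carrier_mat n m"
    and r: "strict_mono_on {..<k} r" "\<And>i. i < k \<Longrightarrow> r i < n"
    and s: "strict_mono_on {..<l} s" "\<And>j. j < l \<Longrightarrow> s j < m"
  shows "submatrix A (r ` {..<k}) (s ` {..<l}) = mat k l (\<lambda>(i, j). A $$ (r i, s j))"
proof -
  have pick: "pick (r ` {..<k}) i = r i" if "strict_mono_on {..<k} r" "i < k"
    for r :: "nat \<Rightarrow> nat" and k i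
  proof -
    have inj: "inj_on r {..<k}" using that(1) by (rule strict_mono_on_imp_inj_on)
    have "{a \<in> r ` {..<k}. a < r i} = r ` {..<i}"
      using that strict_mono_on_less[OF that(1)] by auto
    moreover have "card (r ` {..<i}) = i"
      using inj that(2) by (subst card_image) (auto intro: inj_on_subset)
    ultimately show ?thesis using pick_card_in_set[of "r i" "r ` {..<k}"] that(2) by simp
  qed
  have card: "card {i. i < n \<and> i \<in> r ` {..<k}} = k"
    if "strict_mono_on {..<k} r" "\<And>i. i < k \<Longrightarrow> r i < n" for r :: "nat \<Rightarrow> nat" and k n
  proof -
    have "{i. i < n \<and> i \<in> r ` {..<k}} = r ` {..<k}" using that(2) by auto
    then show ?thesis using card_image[OF strict_mono_on_imp_inj_on[OF that(1)]] by simp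
  qed
  show ?thesis
    unfolding submatrix_def using A card[OF r] card[OF s]
    by (auto intro!: eq_matI simp: pick[OF r(1)] pick[OF s(1)])
qed

lemma square_submatricesI:
  assumes "A \<in> carrier_mat n m" "0 < k"
    and "strict_mono_on {..<k} r" "\<And>i. i < k \<Longrightarrow> r i < n"
    and "strict_mono_on {..<k} s" "\<And>j. j < k \<Longrightarrow> s j < m"
  shows "mat k k (\<lambda>(i, j). A $$ (r i, s j)) \<in> square_submatrices A"
proof -
  have "card (r ` {..<k}) = k" "card (s ` {..<k}) = k"
    using assms(3,5) by (simp_all add: card_image strict_mono_on_imp_inj_on)
  moreover have "r ` {..<k} \<subseteq> {..<n}" "s ` {..<k} \<subseteq> {..<m}" using assms(4,6) by auto
  ultimately show ?thesis
    using submatrix_strict_mono[OF assms(1,3,4,5,6)] assms(1,2)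
    unfolding square_submatrices_def by (metis (mono_tags, lifting) carrier_matD mem_Collect_eq)
qed

lemma square_submatricesE:
  assumes "B \<in> square_submatrices A" and A: "A \<in> carrier_mat n m"
  obtains k r s where "0 < k" "B = mat k k (\<lambda>(i, j). A $$ (r i, s j))"
    and "strict_mono_on {..<k} r" "\<And>i. i < k \<Longrightarrow> r i < n"
    and "strict_mono_on {..<k} s" "\<And>j. j < k \<Longrightarrow> s j < m"
proof -
  obtain I J where IJ: "B = submatrix A I J" "I \<subseteq> {..<n}" "J \<subseteq> {..<m}" "card I = card J" "card I > 0"
    using assms unfolding square_submatrices_def by auto
  have mono: "strict_mono_on {..<card I} (pick I)" for I
    by (rule strict_mono_onI) (use pick_mono_le in auto)
  have less: "pick I i < n" if "I \<subseteq> {..<n}" "i < card I" for I n i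
    using pick_in_set_le[OF that(2)] that(1) by auto
  have "{i. i < n \<and> i \<in> I} = I" "{i. i < m \<and> i \<in> J} = J" using IJ by auto
  then have "B = mat (card I) (card I) (\<lambda>(i, j). A $$ (pick I i, pick J j))"
    using A IJ unfolding IJ(1) submatrix_def by auto
  then show ?thesis
    using that[of "card I" "pick I" "pick J"] IJ mono[of I] mono[of J] less by metis
qed

lemma strict_mono_on_pair:
  "(i :: nat) < i' \<Longrightarrow> strict_mono_on {..<2} (\<lambda>x :: nat. if x = 0 then i else i')"
  by (rule strict_mono_onI) auto

lemma square_submatrices_entry:
  assumes "A \<in> carrier_mat n m" "i < n" "j < m"
  shows "mat 1 1 (\<lambda>_. A $$ (i, j)) \<in> square_submatrices A"
proof -
  have "mat 1 1 (\<lambda>(x, y). A $$ (i, j)) \<in> square_submatrices A"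
    using assms by (intro square_submatricesI[where r = "\<lambda>_. i" and s = "\<lambda>_. j"])
      (auto intro: strict_mono_onI)
  then show ?thesis by (simp add: case_prod_beta')
qed

lemma square_submatrices_pair:
  assumes "A \<in> carrier_mat n m" "i < i'" "i' < n" "j < j'" "j' < m"
  shows "mat 2 2 (\<lambda>(x, y). A $$ (if x = 0 then i else i', if y = 0 then j else j'))
    \<in> square_submatrices A"
  using assms by (intro square_submatricesI strict_mono_on_pair) auto

lemma square_submatrices_self:
  assumes "A \<in> carrier_mat n n" "0 < n"
  shows "A \<in> square_submatrices A"
proof -
  have "mat n n (\<lambda>(i, j). A $$ (id i, id j)) \<in> square_submatrices A"
    using assms by (intro square_submatricesI) (auto intro: strict_mono_onI)
  moreover have "mat n n (\<lambda>(i, j). A $$ (id i, id j)) = A" using assms by (intro eq_matI) auto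
  ultimately show ?thesis by simp
qed

section \<open>Tropical minors\<close>

lemma weight_le_per:
  assumes "\<sigma> permutes {0..<dim_row M}"
  shows "weight M \<sigma> \<le> per M"
  unfolding per_def by (rule Max_ge) (use assms finite_permutations in auto)

lemma per_attained:
  obtains \<sigma> where "\<sigma> permutes {0..<dim_row M}" "per M = weight M \<sigma>"
proof -
  have "per M \<in> weight M ` {\<sigma>. \<sigma> permutes {0..<dim_row M}}"
    unfolding per_def by (rule Max_in) (auto simp: finite_permutations intro: permutes_id)
  then show ?thesis using that by auto
qed

lemma per_eq_weight_idI:
  assumes "\<And>\<sigma>. \<sigma> permutes {0..<dim_row M} \<Longrightarrow> weight M \<sigma> \<le> weight M id"
  shows "per M = weight M id"
  using per_attained[of M] assms weight_le_per[OF permutes_id, of M] by (metis antisym)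

lemma permutes_2_iff: "\<sigma> permutes {0..<2 :: nat} \<longleftrightarrow> \<sigma> = id \<or> \<sigma> = transpose 0 1"
proof -
  have "{0..<2 :: nat} = {0, 1}" by auto
  then show ?thesis by (simp add: permutes_doubleton_iff)
qed

lemma per_size_2:
  assumes "M \<in> carrier_mat 2 2"
  shows "per M = max (weight M id) (weight M (transpose 0 1))"
    and "weight M id = M $$ (0, 0) * M $$ (1, 1)"
    and "weight M (transpose 0 1) = M $$ (0, 1) * M $$ (1, 0)"
proof -
  have *: "{0..<2 :: nat} = {0, 1}" by auto
  show "weight M id = M $$ (0, 0) * M $$ (1, 1)"
    "weight M (transpose 0 1) = M $$ (0, 1) * M $$ (1, 0)"
    using assms by (simp_all add: weight_def *)
  have "{\<sigma>. \<sigma> permutes {0..<2 :: nat}} = {id, transpose 0 1}" by (auto simp: permutes_2_iff)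
  then show "per M = max (weight M id) (weight M (transpose 0 1))"
    using assms by (simp add: per_def)
qed

lemma not_evenperm_transpose: "\<not> evenperm (transpose 0 (1 :: nat))"
  by (simp add: evenperm_swap)

lemma trop_nonneg_size_2D:
  assumes M: "M \<in> carrier_mat 2 2" and "trop_nonneg M"
  shows "M $$ (0, 1) * M $$ (1, 0) \<le> M $$ (0, 0) * M $$ (1, 1)"
proof (rule ccontr)
  assume "\<not> ?thesis"
  then have less: "weight M id < weight M (transpose 0 1)" using per_size_2[OF M] by simp
  then have per: "per M = weight M (transpose 0 1)"
    unfolding per_size_2(1)[OF M] by (intro max_absorb2) (rule less_imp_le)
  have "max_perms M = {transpose 0 1}"
    using M less by (auto simp: max_perms_def per permutes_2_iff)
  moreover have "per M \<noteq> MInf" using less unfolding per by (auto simp: less_rmax_def)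
  ultimately show False
    using assms(2) not_evenperm_transpose
    by (auto simp: trop_nonneg_def trop_positive_def sign_nonsingular_def)
qed

lemma trop_positive_size_2D:
  assumes M: "M \<in> carrier_mat 2 2" and "trop_positive M"
  shows "M $$ (0, 1) * M $$ (1, 0) < M $$ (0, 0) * M $$ (1, 1)"
proof (rule ccontr)
  assume "\<not> ?thesis"
  then have "weight M id \<le> weight M (transpose 0 1)" using per_size_2[OF M] by simp
  then have per: "per M = weight M (transpose 0 1)"
    unfolding per_size_2(1)[OF M] by (rule max_absorb2)
  then have "transpose 0 1 \<in> max_perms M" using M by (auto simp: max_perms_def permutes_2_iff)
  then show False using assms(2) not_evenperm_transpose by (auto simp: trop_positive_def)
qed

lemma trop_positive_size_1D:
  assumes "M \<in> carrier_mat 1 1" and "trop_positive M"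
  shows "M $$ (0, 0) \<noteq> MInf"
  using assms by (auto simp: trop_positive_def per_def weight_def)

abbreviation trop_monge :: "nat \<Rightarrow> nat \<Rightarrow> rmax mat \<Rightarrow> bool" where
  "trop_monge n m A \<equiv> mult_monge 1 n m (\<lambda>i j. A $$ (i, j))"

lemma TNtrop2_imp_trop_monge:
  assumes "A \<in> TNtrop2 n m"
  shows "trop_monge n m A"
  unfolding mult_monge_def
proof (intro allI impI)
  fix i i' j j' assume ij: "i < i' \<and> i' < n \<and> j < j' \<and> j' < m"
  let ?B = "mat 2 2 (\<lambda>(x, y). A $$ (if x = 0 then i else i', if y = 0 then j else j'))"
  have "?B \<in> square_submatrices A"
    using assms ij by (intro square_submatrices_pair) (auto simp: TNtrop2_def)
  then have "trop_nonneg ?B" using assms by (auto simp: TNtrop2_def)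
  then show "1 * (A $$ (i, j') * A $$ (i', j)) \<le> A $$ (i, j) * A $$ (i', j')"
    using trop_nonneg_size_2D[of ?B] by simp
qed

lemma trop_monge_imp_DDtrop:
  assumes A: "A \<in> carrier_mat n m" and monge: "trop_monge n m A"
  shows "A \<in> DDtrop n m"
proof -
  have "trop_diag_dominant B" if "B \<in> square_submatrices A" for B
    using that A
  proof (cases rule: square_submatricesE)
    case (1 k r s)
    have B: "dim_row B = k" "\<And>i j. i < k \<Longrightarrow> j < k \<Longrightarrow> B $$ (i, j) = A $$ (r i, s j)"
      using 1 by auto
    have "mult_monge 1 k k (\<lambda>i j. A $$ (r i, s j))"
      by (rule mult_monge_subindices[OF monge]) (use 1 in auto)
    from mult_monge_prod_le(2)[OF this]
    have "(\<Prod>l = 0..<k. A $$ (r l, s (\<sigma> l))) \<le> (\<Prod>l = 0..<k. A $$ (r l, s l))"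
      if "\<sigma> permutes {0..<k}" for \<sigma> using that by simp
    moreover have "weight B \<sigma> = (\<Prod>l = 0..<k. A $$ (r l, s (\<sigma> l)))" if "\<sigma> permutes {0..<k}" for \<sigma>
      unfolding weight_def B(1)
      by (rule prod.cong) (use permutes_in_image[OF that] B(2) in auto)
    ultimately show ?thesis
      unfolding trop_diag_dominant_def using B(1) by (intro per_eq_weight_idI) (simp add: permutes_id)
  qed
  then show ?thesis using A by (simp add: DDtrop_def)
qed

lemma TNtrop_subset_TNtrop2: "TNtrop n m \<subseteq> TNtrop2 n m"
  by (auto simp: TNtrop_def TNtrop2_def)

text \<open>The Monge inequalities are the minors of size two, and by sorting they imply that the diagonal
  dominates in every minor. A dominant diagonal makes the identity a permutation of maximal weight, so
  that the minor cannot be negative. The four classes are thus linked in a circle.\<close>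

lemma TNtrop_eq:
  shows "TNtrop n m = {A \<in> carrier_mat n m. trop_monge n m A}"
    and "TNtrop2 n m = {A \<in> carrier_mat n m. trop_monge n m A}"
    and "DDtrop n m = {A \<in> carrier_mat n m. trop_monge n m A}"
proof -
  have "TNtrop2 n m \<subseteq> {A \<in> carrier_mat n m. trop_monge n m A}"
    using TNtrop2_imp_trop_monge by (auto simp: TNtrop2_def)
  moreover have "{A \<in> carrier_mat n m. trop_monge n m A} \<subseteq> DDtrop n m"
    using trop_monge_imp_DDtrop by auto
  ultimately show "TNtrop n m = {A \<in> carrier_mat n m. trop_monge n m A}"
    "TNtrop2 n m = {A \<in> carrier_mat n m. trop_monge n m A}"
    "DDtrop n m = {A \<in> carrier_mat n m. trop_monge n m A}"
    using DDtrop_subset_TNtrop[of n m] TNtrop_subset_TNtrop2[of n m] by blast+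
qed

text \<open>If there is a permutation other than the identity, then \<open>k \<ge> 2\<close> and the strict inequalities
  force the diagonal to be finite, so that no permutation of weight $-\infty$ can compete. The others
  gain strictly with each swap that undoes an inversion.\<close>

lemma strict_mult_monge_prod_less:
  fixes f :: "nat \<Rightarrow> nat \<Rightarrow> rmax"
  assumes f: "strict_mult_monge k k f" and "\<sigma> permutes {0..<k}" "\<sigma> \<noteq> id"
  shows "(\<Prod>l = 0..<k. f l (\<sigma> l)) < (\<Prod>l = 0..<k. f l l)"
proof -
  have "2 \<le> k"
  proof (rule ccontr)
    assume "\<not> 2 \<le> k"
    then have "k = 0 \<or> k = 1" by auto
    then have "\<sigma> = id" using assms(2) by auto
    then show False using assms(3) by simp
  qed
  have "f i i \<noteq> MInf" if "i < k" for i
  proof -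
    obtain j where j: "j < k" "j \<noteq> i"
      using that[of "if i = 0 then 1 else 0"] \<open>2 \<le> k\<close> by (auto split: if_splits)
    then have "\<exists>x. x < f i i * f j j"
      using strict_mult_mongeD[OF f, of i j i j] strict_mult_mongeD[OF f, of j i j i] that
      by (metis linorder_neqE_nat mult.commute)
    then show ?thesis by (auto simp: less_rmax_def)
  qed
  then have diag: "(\<Prod>l = 0..<k. f l l) \<noteq> MInf" by (simp add: prod_eq_MInf_iff)
  have "\<sigma> \<noteq> id \<longrightarrow> (\<Prod>l = 0..<k. f l (\<sigma> l)) < (\<Prod>l = 0..<k. f l l)"
    using assms(2)
  proof (induction rule: permutes_sort_induct)
    case (swap \<sigma> i j)
    let ?\<tau> = "\<sigma> \<circ> transpose i j"
    obtain r where r: "(\<Prod>l = 0..<k. f l (\<sigma> l)) = f i (\<sigma> i) * f j (\<sigma> j) * r"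
      "(\<Prod>l = 0..<k. f l (?\<tau> l)) = f i (\<sigma> j) * f j (\<sigma> i) * r"
      by (rule prod_swap[OF swap(2,3), of f \<sigma>])
    show ?case
    proof (cases "r = MInf")
      case True
      then show ?thesis using diag unfolding r(1) by simp
    next
      case False
      have "\<sigma> i < k" using permutes_in_image[OF swap(1), of i] swap(2,3) by auto
      then have "f i (\<sigma> i) * f j (\<sigma> j) < f i (\<sigma> j) * f j (\<sigma> i)"
        using strict_mult_mongeD[OF f swap(2,3,4)] by simp
      then have step: "(\<Prod>l = 0..<k. f l (\<sigma> l)) < (\<Prod>l = 0..<k. f l (?\<tau> l))"
        unfolding r using rmax_mult_strict_right_mono[OF _ False] by simp
      show ?thesis
      proof (cases "?\<tau> = id")
        case True
        then show ?thesis using step unfolding True by simp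
      next
        case False
        then have "(\<Prod>l = 0..<k. f l (?\<tau> l)) < (\<Prod>l = 0..<k. f l l)" using swap.IH by blast
        then show ?thesis using step by (blast intro: less_trans)
      qed
    qed
  qed simp
  then show ?thesis using assms(3) by simp
qed

section \<open>Strictly positive tropical minors and strict Monge matrices\<close>

lemma real_mats_iff:
  "A \<in> real_mats n m \<longleftrightarrow> A \<in> carrier_mat n m \<and> (\<forall>i<n. \<forall>j<m. A $$ (i, j) \<noteq> MInf)"
proof
  assume A: "A \<in> carrier_mat n m \<and> (\<forall>i<n. \<forall>j<m. A $$ (i, j) \<noteq> MInf)"
  define R where "R = map_mat (\<lambda>x. case x of MInf \<Rightarrow> 0 | Fin a \<Rightarrow> a) A"
  have "A = map_mat Fin R"
    using A by (intro eq_matI) (auto simp: R_def split: rmax.splits)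
  moreover have "R \<in> carrier_mat n m" using A by (simp add: R_def)
  ultimately show "A \<in> real_mats n m" by (simp add: real_mats_def)
qed (auto simp: real_mats_def)

lemma map_Fin_monge: "map_mat Fin ` {A \<in> carrier_mat n m. monge A} =
  {A \<in> real_mats n m. trop_monge n m A}"
proof -
  have "monge A \<longleftrightarrow> trop_monge n m (map_mat Fin A)" if "A \<in> carrier_mat n m" for A
    using that by (auto simp: monge_def mult_monge_def)
  then show ?thesis by (auto simp: real_mats_def)
qed

lemma map_Fin_strict_monge: "map_mat Fin ` {A \<in> carrier_mat n m. strict_monge A} =
  {A \<in> real_mats n m. strict_mult_monge n m (\<lambda>i j. A $$ (i, j))}"
proof -
  have "strict_monge A \<longleftrightarrow> strict_mult_monge n m (\<lambda>i j. map_mat Fin A $$ (i, j))"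
    if "A \<in> carrier_mat n m" for A
    using that by (auto simp: strict_monge_def strict_mult_monge_def)
  then show ?thesis by (auto simp: real_mats_def)
qed

lemma TPtrop2_imp_strict_mult_monge:
  assumes "A \<in> TPtrop2 n m"
  shows "A \<in> real_mats n m" and "strict_mult_monge n m (\<lambda>i j. A $$ (i, j))"
proof -
  have A: "A \<in> carrier_mat n m" using assms by (simp add: TPtrop2_def)
  have "A $$ (i, j) \<noteq> MInf" if "i < n" "j < m" for i j
  proof -
    have "trop_positive (mat 1 1 (\<lambda>_. A $$ (i, j)))"
      using square_submatrices_entry[OF A that] assms by (auto simp: TPtrop2_def)
    then show ?thesis using trop_positive_size_1D[of "mat 1 1 (\<lambda>_. A $$ (i, j))"] by simp
  qed
  then show "A \<in> real_mats n m" using A by (simp add: real_mats_iff)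
  show "strict_mult_monge n m (\<lambda>i j. A $$ (i, j))"
    unfolding strict_mult_monge_def
  proof (intro allI impI)
    fix i i' j j' assume ij: "i < i' \<and> i' < n \<and> j < j' \<and> j' < m"
    let ?B = "mat 2 2 (\<lambda>(x, y). A $$ (if x = 0 then i else i', if y = 0 then j else j'))"
    have "?B \<in> square_submatrices A" using A ij by (intro square_submatrices_pair) auto
    then have "trop_positive ?B" using assms by (auto simp: TPtrop2_def)
    then show "A $$ (i, j') * A $$ (i', j) < A $$ (i, j) * A $$ (i', j')"
      using trop_positive_size_2D[of ?B] by simp
  qed
qed

lemma strict_mult_monge_submatrix:
  assumes A: "A \<in> carrier_mat n m" and monge: "strict_mult_monge n m (\<lambda>i j. A $$ (i, j))"
    and B: "B \<in> square_submatrices A"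
    and \<sigma>: "\<sigma> permutes {0..<dim_row B}" "\<sigma> \<noteq> id"
  shows "weight B \<sigma> < weight B id"
  using B A
proof (cases rule: square_submatricesE)
  case (1 k r s)
  have "strict_mult_monge k k (\<lambda>i j. A $$ (r i, s j))"
    by (rule strict_mult_monge_subindices[OF monge]) (use 1 in auto)
  from strict_mult_monge_prod_less[OF this _ \<sigma>(2)]
  have "(\<Prod>l = 0..<k. A $$ (r l, s (\<sigma> l))) < (\<Prod>l = 0..<k. A $$ (r l, s l))"
    using \<sigma>(1) 1 by simp
  moreover have "weight B \<tau> = (\<Prod>l = 0..<k. A $$ (r l, s (\<tau> l)))" if "\<tau> permutes {0..<k}" for \<tau>
  proof -
    have "weight B \<tau> = (\<Prod>l = 0..<k. B $$ (l, \<tau> l))" using 1 by (simp add: weight_def)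
    also have "\<dots> = (\<Prod>l = 0..<k. A $$ (r l, s (\<tau> l)))"
      by (rule prod.cong) (use permutes_in_image[OF that] 1(2) in auto)
    finally show ?thesis .
  qed
  ultimately show ?thesis using \<sigma>(1) 1(2) permutes_id by simp
qed

lemma strict_mult_monge_imp_SDDtrop:
  assumes A: "A \<in> carrier_mat n m" and monge: "strict_mult_monge n m (\<lambda>i j. A $$ (i, j))"
  shows "A \<in> SDDtrop n m"
  unfolding SDDtrop_def trop_strictly_diag_dominant_def
  using A strict_mult_monge_submatrix[OF A monge] weight_le_per[OF permutes_id]
  by (blast intro: less_le_trans)

lemma strict_mult_monge_imp_TPtrop:
  assumes A: "A \<in> real_mats n m" and monge: "strict_mult_monge n m (\<lambda>i j. A $$ (i, j))"
  shows "A \<in> TPtrop n m"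
proof -
  have A': "A \<in> carrier_mat n m" using A by (simp add: real_mats_iff)
  have "trop_positive B" if B: "B \<in> square_submatrices A" for B
  proof -
    have "\<sigma> = id" if "\<sigma> \<in> max_perms B" for \<sigma>
    proof (rule ccontr)
      assume "\<sigma> \<noteq> id"
      then have "weight B \<sigma> < weight B id"
        using that by (intro strict_mult_monge_submatrix[OF A' monge B]) (auto simp: max_perms_def)
      also have "\<dots> \<le> per B" by (intro weight_le_per permutes_id)
      finally show False using that by (simp add: max_perms_def)
    qed
    moreover have "per B \<noteq> MInf"
    proof -
      have "weight B id \<noteq> MInf"
        using B A'
      proof (cases rule: square_submatricesE)
        case (1 k r s)
        then show ?thesis using A by (simp add: weight_def prod_eq_MInf_iff real_mats_iff)
      qed
      then show ?thesis using weight_le_per[OF permutes_id, of B]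
        by (cases "weight B id"; cases "per B") auto
    qed
    ultimately show ?thesis unfolding trop_positive_def by (metis evenperm_id)
  qed
  then show ?thesis using A by (simp add: TPtrop_def)
qed

lemma TPtrop_eq:
  shows "TPtrop n m = {A \<in> real_mats n m. strict_mult_monge n m (\<lambda>i j. A $$ (i, j))}"
    and "TPtrop2 n m = {A \<in> real_mats n m. strict_mult_monge n m (\<lambda>i j. A $$ (i, j))}"
proof -
  have "TPtrop n m \<subseteq> TPtrop2 n m" by (auto simp: TPtrop_def TPtrop2_def real_mats_iff)
  moreover have "TPtrop2 n m \<subseteq> {A \<in> real_mats n m. strict_mult_monge n m (\<lambda>i j. A $$ (i, j))}"
    using TPtrop2_imp_strict_mult_monge by blast
  moreover have "{A \<in> real_mats n m. strict_mult_monge n m (\<lambda>i j. A $$ (i, j))} \<subseteq> TPtrop n m"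
    using strict_mult_monge_imp_TPtrop by blast
  ultimately show "TPtrop n m = {A \<in> real_mats n m. strict_mult_monge n m (\<lambda>i j. A $$ (i, j))}"
    "TPtrop2 n m = {A \<in> real_mats n m. strict_mult_monge n m (\<lambda>i j. A $$ (i, j))}"
    by blast+
qed

lemma nat_rearrangement:
  fixes i i' j j' :: nat
  assumes "i < i'" "j < j'"
  shows "i * j' + i' * j < i * j + i' * j'"
proof -
  obtain d e where "i' = i + Suc d" "j' = j + Suc e"
    using assms less_iff_Suc_add by (metis add_Suc_right)
  then show ?thesis by (simp add: algebra_simps)
qed

text \<open>The entry in the upper right corner lies on no diagonal of a square submatrix of size at
  least two, so that it may be $-\infty$ in a matrix of \<^const>\<open>SDDtrop\<close>.\<close>

lemma TPtrop2_psubset_SDDtrop: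
  assumes "0 < n" "0 < m"
  shows "TPtrop2 n m \<subset> SDDtrop n m"
proof -
  define W where
    "W = mat n m (\<lambda>(i, j). if i = 0 \<and> j = m - 1 then MInf else Fin (real (i * j)))"
  have "strict_mult_monge n m (\<lambda>i j. W $$ (i, j))"
    unfolding strict_mult_monge_def
  proof (intro allI impI)
    fix i i' j j' assume ij: "i < i' \<and> i' < n \<and> j < j' \<and> j' < m"
    have "W $$ (i, j') * W $$ (i', j) \<le> Fin (real (i * j' + i' * j))" using ij by (auto simp: W_def)
    also have "\<dots> < Fin (real (i * j + i' * j'))"
      using nat_rearrangement[of i i' j j'] ij unfolding Fin_less_iff of_nat_less_iff by simp
    also have "\<dots> = W $$ (i, j) * W $$ (i', j')" using ij by (auto simp: W_def)
    finally show "W $$ (i, j') * W $$ (i', j) < W $$ (i, j) * W $$ (i', j')" .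
  qed
  then have "W \<in> SDDtrop n m" by (intro strict_mult_monge_imp_SDDtrop) (simp_all add: W_def)
  moreover have "W $$ (0, m - 1) = MInf" using assms by (simp add: W_def)
  then have "W \<notin> TPtrop2 n m" using assms by (auto simp: TPtrop_eq real_mats_iff)
  moreover have "TPtrop2 n m \<subseteq> SDDtrop n m"
    using strict_mult_monge_imp_SDDtrop by (auto simp: TPtrop_eq real_mats_iff)
  ultimately show ?thesis by blast
qed

section \<open>The valuation and its section by monomials\<close>

lemma val_0 [simp]: "val 0 = MInf"
  by (simp add: val_def)

lemma val_eq_MInf_iff [simp]: "val f = MInf \<longleftrightarrow> f = 0"
  by (simp add: val_def)

lemma val_eqI:
  assumes "coeff_of f a \<noteq> 0" "\<And>x. x > a \<Longrightarrow> coeff_of f x = 0"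
  shows "val f = Fin a"
proof -
  have "f \<noteq> 0" using assms(1) by auto
  then show ?thesis using lead_exp_eqI[OF assms] by (simp add: val_def)
qed

lemma val_mult: "val (f * g) = val f * val g"
proof (cases "f = 0 \<or> g = 0")
  case False
  then have "val (f * g) = Fin (lead_exp f + lead_exp g)"
    using coeff_mult_top[of "lead_exp f" f "lead_exp g" g] coeff_lead_exp coeff_above_lead_exp
    by (intro val_eqI) auto
  then show ?thesis using False by (simp add: val_def)
qed auto

lemma val_mono:
  assumes "0 \<le> f" "f \<le> g"
  shows "val f \<le> val g"
proof (rule ccontr)
  assume "\<not> ?thesis"
  then have less: "val g < val f" by simp
  then have "f \<noteq> 0" by (auto simp: less_rmax_def)
  then have f: "coeff_of f (lead_exp f) > 0"
    using assms(1) by (auto simp: less_eq_puiseux_def less_puiseux_def puiseux_pos_def)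
  have g: "coeff_of g x = 0" if "x \<ge> lead_exp f" for x
    using less that coeff_above_lead_exp[of g x] \<open>f \<noteq> 0\<close>
    by (cases "g = 0") (auto simp: val_def less_rmax_def)
  have "puiseux_pos (f - g)"
    by (rule puiseux_posI[of _ "lead_exp f"])
      (use f g coeff_above_lead_exp[OF \<open>f \<noteq> 0\<close>] in auto)
  then show False using assms(2) by (simp add: less_puiseux_def[symmetric])
qed

fun tpow :: "rmax \<Rightarrow> puiseux" where
  "tpow MInf = 0"
| "tpow (Fin b) = t_monom 1 b"

lemma val_tpow [simp]: "val (tpow x) = x"
  by (cases x) (auto intro!: val_eqI simp: coeff_t_monom)

lemma tpow_mult: "tpow (x * y) = tpow x * tpow y"
proof -
  have "t_monom 1 (a + b) = t_monom 1 a * t_monom 1 b" for a b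
  proof (rule puiseux_eqI)
    fix c
    have "coeff_of (t_monom 1 a * t_monom 1 b) c = (\<Sum>x\<in>{a}. coeff_of (t_monom 1 a) x *
        coeff_of (t_monom 1 b) (c - x))"
      unfolding coeff_mult by (rule conv_superset) (auto simp: coeff_t_monom split: if_splits)
    then show "coeff_of (t_monom 1 (a + b)) c = coeff_of (t_monom 1 a * t_monom 1 b) c"
      by (auto simp: coeff_t_monom)
  qed
  then show ?thesis by (cases x; cases y) auto
qed

lemma tpow_pos: "x \<noteq> MInf \<Longrightarrow> 0 < tpow x"
  by (cases x) (auto simp: less_puiseux_def coeff_t_monom intro!: puiseux_posI)

lemma tpow_nonneg [simp]: "0 \<le> tpow x"
  using tpow_pos[of x] by (cases x) auto

lemma tpow_mono: "x \<le> y \<Longrightarrow> tpow x \<le> tpow y"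
proof (cases x; cases y)
  fix a b assume *: "x \<le> y" "x = Fin a" "y = Fin b"
  show ?thesis
  proof (cases "a = b")
    case False
    then have "puiseux_pos (t_monom 1 b - t_monom 1 a)"
      using * by (intro puiseux_posI[of _ b]) (auto simp: coeff_t_monom)
    then show ?thesis using * by (simp add: less_puiseux_def[symmetric] less_imp_le)
  qed (use * in simp)
qed (use tpow_nonneg[of y] in auto)

lemma val_of_nat: "0 < N \<Longrightarrow> val (of_nat N) = 1"
proof -
  have "coeff_of (of_nat N) b = (if b = 0 then real N else 0)" for b
    by (induction N) (auto simp: coeff_1)
  then show "0 < N \<Longrightarrow> val (of_nat N) = 1"
    unfolding one_rmax_def by (intro val_eqI) auto
qed

section \<open>Lifting to totally nonnegative matrices\<close>

text \<open>Monomials alone would lift an inequality of two-by-two minors to a weak inequality. The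
  coefficients \<open>N ^ (i * j)\<close> form a matrix in which it is strict by a factor \<open>N\<close>, so that
  a large \<open>N\<close> settles the ties of the valuations in favour of the diagonal.\<close>

definition lift_mat :: "nat \<Rightarrow> rmax mat \<Rightarrow> puiseux mat" where
  "lift_mat N A = mat (dim_row A) (dim_col A) (\<lambda>(i, j). of_nat (N ^ (i * j)) * tpow (A $$ (i, j)))"

lemma lift_mat_carrier [simp]: "A \<in> carrier_mat n m \<Longrightarrow> lift_mat N A \<in> carrier_mat n m"
  by (simp add: lift_mat_def)

lemma lift_mat_index:
  "A \<in> carrier_mat n m \<Longrightarrow> i < n \<Longrightarrow> j < m \<Longrightarrow>
    lift_mat N A $$ (i, j) = of_nat (N ^ (i * j)) * tpow (A $$ (i, j))"
  by (simp add: lift_mat_def)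

lemma val_lift_mat: "0 < N \<Longrightarrow> val_mat (lift_mat N A) = A"
  by (intro eq_matI) (auto simp: lift_mat_def val_mult val_of_nat simp del: of_nat_power)

lemma lift_mat_mult_monge:
  assumes A: "A \<in> carrier_mat n m" and monge: "trop_monge n m A" and N: "0 < N"
  shows "mult_monge (of_nat N) n m (\<lambda>i j. lift_mat N A $$ (i, j))"
  unfolding mult_monge_def
proof (intro allI impI)
  fix i i' j j' assume ij: "i < i' \<and> i' < n \<and> j < j' \<and> j' < m"
  let ?p = "\<lambda>e. of_nat (N ^ e) :: puiseux"
  have "of_nat N * (lift_mat N A $$ (i, j') * lift_mat N A $$ (i', j)) =
      ?p (Suc (i * j' + i' * j)) * tpow (A $$ (i, j') * A $$ (i', j))"
    using ij by (simp add: lift_mat_index[OF A] tpow_mult power_add ac_simps)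
  also have "\<dots> \<le> ?p (i * j + i' * j') * tpow (A $$ (i, j) * A $$ (i', j'))"
  proof (rule mult_mono)
    have "N ^ Suc (i * j' + i' * j) \<le> N ^ (i * j + i' * j')"
      using nat_rearrangement[of i i' j j'] ij N by (intro power_increasing) auto
    then show "?p (Suc (i * j' + i' * j)) \<le> ?p (i * j + i' * j')"
      unfolding of_nat_le_iff .
    show "tpow (A $$ (i, j') * A $$ (i', j)) \<le> tpow (A $$ (i, j) * A $$ (i', j'))"
      using mult_mongeD[OF monge, of i i' j j'] ij by (intro tpow_mono) simp
  qed auto
  also have "\<dots> = lift_mat N A $$ (i, j) * lift_mat N A $$ (i', j')"
    using ij by (simp add: lift_mat_index[OF A] tpow_mult power_add ac_simps)
  finally show "of_nat N * (lift_mat N A $$ (i, j') * lift_mat N A $$ (i', j)) \<le>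
    lift_mat N A $$ (i, j) * lift_mat N A $$ (i', j')" .
qed

lemma lift_mat_minor:
  assumes A: "A \<in> carrier_mat n m" and monge: "trop_monge n m A"
    and r: "strict_mono_on {..<k} r" "\<And>i. i < k \<Longrightarrow> r i < n"
    and s: "strict_mono_on {..<k} s" "\<And>j. j < k \<Longrightarrow> s j < m"
  defines "B \<equiv> mat k k (\<lambda>(i, j). lift_mat (fact n) A $$ (r i, s j))"
  shows "0 \<le> det B" and "(\<And>i. i < k \<Longrightarrow> A $$ (r i, s i) \<noteq> MInf) \<Longrightarrow> 0 < det B"
proof -
  have nonneg: "0 \<le> B $$ (i, j)" if "i < k" "j < k" for i j
    using that r(2) s(2) by (simp add: B_def lift_mat_index[OF A])
  have "r ` {..<k} \<subseteq> {..<n}" using r(2) by auto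
  then have "k \<le> n"
    using card_inj_on_le[OF strict_mono_on_imp_inj_on[OF r(1)], of "{..<n}"] by simp
  have "mult_monge (of_nat (fact n)) k k (\<lambda>i j. lift_mat (fact n) A $$ (r i, s j))"
    by (rule mult_monge_subindices[OF lift_mat_mult_monge[OF A monge]]) (use r s in auto)
  then have "mult_monge (of_nat (fact n)) k k (\<lambda>i j. B $$ (i, j))"
    by (simp add: mult_monge_def B_def)
  moreover have "fact k \<le> (of_nat (fact n) :: puiseux)"
    using fact_mono[OF \<open>k \<le> n\<close>] by simp
  ultimately have diag: "(\<Prod>i = 0..<k. B $$ (i, i)) \<le> fact k * det B"
    using nonneg by (intro diag_prod_le_fact_det) (auto simp: B_def)
  have fact: "0 < (fact k :: puiseux)" by simp
  have "0 \<le> (\<Prod>i = 0..<k. B $$ (i, i))" using nonneg by (intro prod_nonneg) auto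
  then have "0 \<le> fact k * det B" using diag by simp
  then show "0 \<le> det B" using fact by (simp add: zero_le_mult_iff)
  assume fin: "\<And>i. i < k \<Longrightarrow> A $$ (r i, s i) \<noteq> MInf"
  have "0 < (\<Prod>i = 0..<k. B $$ (i, i))"
    using r(2) s(2) fin by (intro prod_pos) (auto simp: B_def lift_mat_index[OF A] tpow_pos)
  then have "0 < fact k * det B" using diag by simp
  then show "0 < det B" using fact by (simp add: zero_less_mult_iff)
qed

lemma lift_mat_TN:
  assumes A: "A \<in> carrier_mat n m" and monge: "trop_monge n m A"
  shows "lift_mat (fact n) A \<in> TN n m"
proof -
  have "0 \<le> det B" if "B \<in> square_submatrices (lift_mat (fact n) A)" for B
    using that lift_mat_carrier[OF A]
  proof (cases rule: square_submatricesE)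
    case 1
    then show ?thesis using lift_mat_minor(1)[OF A monge] by blast
  qed
  then show ?thesis using A by (simp add: TN_def)
qed

lemma lift_mat_TP:
  assumes A: "A \<in> real_mats n m" and monge: "trop_monge n m A"
  shows "lift_mat (fact n) A \<in> TP n m"
proof -
  have A': "A \<in> carrier_mat n m" and fin: "\<And>i j. i < n \<Longrightarrow> j < m \<Longrightarrow> A $$ (i, j) \<noteq> MInf"
    using A by (auto simp: real_mats_iff)
  have "0 < det B" if "B \<in> square_submatrices (lift_mat (fact n) A)" for B
    using that lift_mat_carrier[OF A']
  proof (cases rule: square_submatricesE)
    case 1
    then show ?thesis using lift_mat_minor(2)[OF A' monge] fin by blast
  qed
  then show ?thesis using A' by (simp add: TP_def)
qed

lemma det_lift_mat_pos:
  assumes A: "A \<in> carrier_mat n n" and monge: "trop_monge n n A"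
    and diag: "\<And>i. i < n \<Longrightarrow> A $$ (i, i) \<noteq> MInf"
  shows "0 < det (lift_mat (fact n) A)"
proof -
  have "lift_mat (fact n) A = mat n n (\<lambda>(i, j). lift_mat (fact n) A $$ (id i, id j))"
    using A by (intro eq_matI) (auto simp: lift_mat_def)
  moreover have "0 < det (mat n n (\<lambda>(i, j). lift_mat (fact n) A $$ (id i, id j)))"
    by (rule lift_mat_minor(2)[OF A monge]) (auto simp: diag intro: strict_mono_onI)
  ultimately show ?thesis by simp
qed

section \<open>Valuations of totally nonnegative matrices\<close>

lemma det_size_2:
  assumes "M \<in> carrier_mat 2 2"
  shows "det M = M $$ (0, 0) * M $$ (1, 1) - M $$ (0, 1) * M $$ (1, 0)"
proof -
  have *: "{0..<2 :: nat} = {0, 1}" by auto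
  have "{\<sigma>. \<sigma> permutes {0..<2 :: nat}} = {id, transpose 0 1}" by (auto simp: permutes_2_iff)
  moreover have "id \<noteq> transpose 0 (1 :: nat)" by (auto simp: fun_eq_iff transpose_def)
  moreover have "sign (transpose 0 (1 :: nat)) = - 1" by (simp add: sign_swap_id)
  ultimately show ?thesis
    unfolding det_def'[OF assms] by (simp add: * sign_id)
qed

lemma TN_entry_nonneg:
  assumes "A \<in> TN n m" "i < n" "j < m"
  shows "0 \<le> A $$ (i, j)"
proof -
  have "A \<in> carrier_mat n m" using assms(1) by (simp add: TN_def)
  from square_submatrices_entry[OF this assms(2,3)] have "0 \<le> det (mat 1 1 (\<lambda>_. A $$ (i, j)))"
    using assms(1) unfolding TN_def by blast
  then show ?thesis using det_single[of "mat 1 1 (\<lambda>_. A $$ (i, j))"] by simp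
qed

lemma TP_entry_pos:
  assumes "A \<in> TP n m" "i < n" "j < m"
  shows "0 < A $$ (i, j)"
proof -
  have "A \<in> carrier_mat n m" using assms(1) by (simp add: TP_def)
  from square_submatrices_entry[OF this assms(2,3)] have "0 < det (mat 1 1 (\<lambda>_. A $$ (i, j)))"
    using assms(1) unfolding TP_def by blast
  then show ?thesis using det_single[of "mat 1 1 (\<lambda>_. A $$ (i, j))"] by simp
qed

text \<open>A nonnegative minor of size two compares two products of nonnegative entries, and the valuation
  is monotone on nonnegative series.\<close>

lemma val_TN_trop_monge:
  assumes "A \<in> TN n m"
  shows "trop_monge n m (val_mat A)"
  unfolding mult_monge_def
proof (intro allI impI)
  fix i i' j j' assume ij: "i < i' \<and> i' < n \<and> j < j' \<and> j' < m"
  have A: "A \<in> carrier_mat n m" using assms by (simp add: TN_def)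
  let ?B = "mat 2 2 (\<lambda>(x, y). A $$ (if x = 0 then i else i', if y = 0 then j else j'))"
  have "?B \<in> square_submatrices A" using A ij by (intro square_submatrices_pair) auto
  then have "0 \<le> det ?B" using assms by (simp add: TN_def)
  then have "A $$ (i, j') * A $$ (i', j) \<le> A $$ (i, j) * A $$ (i', j')"
    using det_size_2[of ?B] by simp
  then have "val (A $$ (i, j') * A $$ (i', j)) \<le> val (A $$ (i, j) * A $$ (i', j'))"
    using TN_entry_nonneg[OF assms] ij by (intro val_mono mult_nonneg_nonneg) auto
  then show "1 * (val_mat A $$ (i, j') * val_mat A $$ (i', j)) \<le>
      val_mat A $$ (i, j) * val_mat A $$ (i', j')"
    using A ij by (simp add: val_mult)
qed

lemma val_TN_eq: "val_mat ` TN n m = {A \<in> carrier_mat n m. trop_monge n m A}"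
proof -
  have "A \<in> val_mat ` TN n m" if "A \<in> carrier_mat n m" "trop_monge n m A" for A
    using lift_mat_TN[OF that] val_lift_mat[of "fact n" A] by (metis fact_gt_zero imageI)
  moreover have "val_mat ` TN n m \<subseteq> carrier_mat n m" by (auto simp: TN_def)
  ultimately show ?thesis using val_TN_trop_monge by blast
qed

lemma TP_subset_TN_nonzero: "TP n m \<subseteq> TN_nonzero n m"
proof
  fix A assume A: "A \<in> TP n m"
  then have "A $$ (i, j) \<noteq> 0" if "i < n" "j < m" for i j using TP_entry_pos[OF A that] by simp
  moreover have "A \<in> TN n m" using A unfolding TP_def TN_def by (auto intro: less_imp_le)
  ultimately show "A \<in> TN_nonzero n m" by (simp add: TN_nonzero_def)
qed

lemma val_TP_eq:
  shows "val_mat ` TP n m = {A \<in> real_mats n m. trop_monge n m A}"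
    and "val_mat ` TN_nonzero n m = {A \<in> real_mats n m. trop_monge n m A}"
proof -
  have "A \<in> val_mat ` TP n m" if "A \<in> real_mats n m" "trop_monge n m A" for A
    using lift_mat_TP[OF that] val_lift_mat[of "fact n" A] by (metis fact_gt_zero imageI)
  moreover have "val_mat ` TN_nonzero n m \<subseteq> real_mats n m"
    by (auto simp: TN_nonzero_def TN_def real_mats_iff)
  then have "val_mat ` TN_nonzero n m \<subseteq> {A \<in> real_mats n m. trop_monge n m A}"
    using val_TN_trop_monge by (auto simp: TN_nonzero_def)
  ultimately show "val_mat ` TP n m = {A \<in> real_mats n m. trop_monge n m A}"
    "val_mat ` TN_nonzero n m = {A \<in> real_mats n m. trop_monge n m A}"
    using image_mono[OF TP_subset_TN_nonzero, of val_mat n m] by blast+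
qed

section \<open>Nonsingular matrices\<close>

lemma invertible_mat_iff_det:
  fixes A :: "'a :: field mat"
  assumes A: "A \<in> carrier_mat n n"
  shows "invertible_mat A \<longleftrightarrow> det A \<noteq> 0"
proof
  assume "invertible_mat A"
  then obtain B where B: "A * B = 1\<^sub>m n" "B * A = 1\<^sub>m (dim_row B)"
    using A by (auto simp: invertible_mat_def inverts_mat_def)
  have "dim_col B = n" "dim_row B = n"
    using arg_cong[OF B(1), of dim_col] arg_cong[OF B(2), of dim_col] A by auto
  then have "B \<in> carrier_mat n n" by auto
  then have "det A * det B = 1" using det_mult[OF A, of B] B(1) by simp
  then show "det A \<noteq> 0" by auto
next
  assume "det A \<noteq> 0"
  from det_non_zero_imp_unit[OF A this, of n]
  obtain B where "B \<in> carrier_mat n n" "A * B = 1\<^sub>m n" "B * A = 1\<^sub>m n"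
    by (auto simp: Units_def ring_mat_def)
  then show "invertible_mat A" using A by (auto simp: invertible_mat_def inverts_mat_def)
qed

text \<open>Since the diagonal dominates, these are the tropically nonnegative square matrices of finite
  permanent. A finite diagonal is easier to follow through products and factorizations.\<close>

definition trop_monge_diag :: "nat \<Rightarrow> rmax mat set" where
  "trop_monge_diag n =
     {A \<in> carrier_mat n n. trop_monge n n A \<and> (\<forall>i<n. A $$ (i, i) \<noteq> MInf)}"

lemma per_finite_iff_diag:
  assumes A: "A \<in> carrier_mat n n" and monge: "trop_monge n n A" and n: "0 < n"
  shows "per A \<noteq> MInf \<longleftrightarrow> (\<forall>i<n. A $$ (i, i) \<noteq> MInf)"
proof -
  have "A \<in> DDtrop n n" using A monge by (rule trop_monge_imp_DDtrop)
  then have "per A = weight A id"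
    using square_submatrices_self[OF A n] by (auto simp: DDtrop_def trop_diag_dominant_def)
  then show ?thesis using A by (auto simp: weight_def prod_eq_MInf_iff)
qed

lemma trop_monge_diag_eq:
  "0 < n \<Longrightarrow> trop_monge_diag n = {A \<in> TNtrop n n. per A \<noteq> MInf}"
  using per_finite_iff_diag by (auto simp: trop_monge_diag_def TNtrop_eq)

text \<open>Some term of the Leibniz formula is nonzero.\<close>

lemma per_val_finite:
  assumes A: "A \<in> carrier_mat n n" and det: "det A \<noteq> 0"
  shows "per (val_mat A) \<noteq> MInf"
proof -
  obtain \<sigma> where \<sigma>: "\<sigma> permutes {0..<n}" "(\<Prod>i = 0..<n. A $$ (i, \<sigma> i)) \<noteq> 0"
    using det det_def'[OF A]
    by (metis (mono_tags, lifting) mem_Collect_eq mult_zero_right sum.neutral)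
  have "weight (val_mat A) \<sigma> = (\<Prod>i = 0..<n. val (A $$ (i, \<sigma> i)))"
    unfolding weight_def
    by (rule prod.cong) (use A permutes_in_image[OF \<sigma>(1)] in auto)
  then have "weight (val_mat A) \<sigma> \<noteq> MInf"
    using \<sigma>(2) by (simp add: prod_eq_MInf_iff)
  then show ?thesis
    using weight_le_per[of \<sigma> "val_mat A"] \<sigma>(1) A
    by (cases "per (val_mat A)"; cases "weight (val_mat A) \<sigma>") auto
qed

lemma val_GL_TN_eq:
  assumes n: "0 < n"
  shows "val_mat ` (GL n \<inter> TN n n) = trop_monge_diag n"
proof
  show "val_mat ` (GL n \<inter> TN n n) \<subseteq> trop_monge_diag n"
  proof
    fix M assume "M \<in> val_mat ` (GL n \<inter> TN n n)"
    then obtain A where A: "A \<in> GL n" "A \<in> TN n n" "M = val_mat A" by auto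
    have "A \<in> carrier_mat n n" "det A \<noteq> 0"
      using A(1) invertible_mat_iff_det by (auto simp: GL_def)
    then show "M \<in> trop_monge_diag n"
      using val_TN_trop_monge[OF A(2)] per_val_finite per_finite_iff_diag[of "val_mat A" n] n A(3)
      by (auto simp: trop_monge_diag_def)
  qed
  show "trop_monge_diag n \<subseteq> val_mat ` (GL n \<inter> TN n n)"
  proof
    fix A assume "A \<in> trop_monge_diag n"
    then have A: "A \<in> carrier_mat n n" "trop_monge n n A" "\<And>i. i < n \<Longrightarrow> A $$ (i, i) \<noteq> MInf"
      by (auto simp: trop_monge_diag_def)
    have "lift_mat (fact n) A \<in> GL n"
      using det_lift_mat_pos[OF A] A(1) invertible_mat_iff_det[of "lift_mat (fact n) A" n]
      by (simp add: GL_def)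
    then show "A \<in> val_mat ` (GL n \<inter> TN n n)"
      using lift_mat_TN[OF A(1,2)] val_lift_mat[of "fact n" A] by (metis IntI fact_gt_zero imageI)
  qed
qed

section \<open>Monge matrices and staircase matrices\<close>

lemma staircase_entry:
  assumes "t < n" "s < m"
  shows "(\<Sum>i = 1..<n. \<Sum>j = 1..<m. c i j * elem_staircase n m i j $$ (t, s)) =
    (\<Sum>i = 1..t. \<Sum>j = 1..s. c i j)"
proof (rule sum.mono_neutral_cong_right)
  show "\<forall>i\<in>{1..<n} - {1..t}. (\<Sum>j = 1..<m. c i j * elem_staircase n m i j $$ (t, s)) = 0"
    using assms by (auto simp: elem_staircase_def)
  fix i assume i: "i \<in> {1..t}"
  show "(\<Sum>j = 1..<m. c i j * elem_staircase n m i j $$ (t, s)) = (\<Sum>j = 1..s. c i j)"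
    by (rule sum.mono_neutral_cong_right) (use i assms in \<open>auto simp: elem_staircase_def\<close>)
qed (use assms in auto)

lemma sum_second_difference:
  fixes f :: "nat \<Rightarrow> nat \<Rightarrow> real"
  shows "(\<Sum>i = 1..t. \<Sum>j = 1..s. f i j + f (i - 1) (j - 1) - f (i - 1) j - f i (j - 1)) =
    f t s - f t 0 - f 0 s + f 0 0"
proof -
  have "(\<Sum>j = 1..s. f i j + f (i - 1) (j - 1) - f (i - 1) j - f i (j - 1)) =
      (f i s - f i 0) - (f (i - 1) s - f (i - 1) 0)" for i
    using sum_telescope''[of 0 s "\<lambda>j. f i j - f (i - 1) j"] by (simp add: algebra_simps)
  then show ?thesis using sum_telescope''[of 0 t "\<lambda>i. f i s - f i 0"] by simp
qed

text \<open>The second difference of a Monge matrix at \<open>(i, j)\<close> is the coefficient of the elementary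
  staircase matrix there. It is a Monge inequality on consecutive rows and columns.\<close>

lemma monge_eq_scaled_staircase:
  "{A \<in> carrier_mat n m. monge A} = scaled_staircase_mats n m"
proof
  show "{A \<in> carrier_mat n m. monge A} \<subseteq> scaled_staircase_mats n m"
  proof
    fix A assume "A \<in> {A \<in> carrier_mat n m. monge A}"
    then have A: "A \<in> carrier_mat n m" "monge A" by auto
    let ?f = "\<lambda>i j. A $$ (i, j)"
    define c where "c i j = (if 1 \<le> i \<and> i < n \<and> 1 \<le> j \<and> j < m
      then ?f i j + ?f (i - 1) (j - 1) - ?f (i - 1) j - ?f i (j - 1) else 0)" for i j
    have "0 \<le> c i j" for i j
    proof (cases "1 \<le> i \<and> i < n \<and> 1 \<le> j \<and> j < m")
      case True
      then have "?f (i - 1) (j - 1) + ?f i j \<ge> ?f (i - 1) j + ?f i (j - 1)"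
        using A by (auto simp: monge_def)
      then show ?thesis using True by (simp add: c_def)
    next
      case False
      then have "c i j = 0" unfolding c_def by (rule if_not_P)
      then show ?thesis by simp
    qed
    moreover define S where "S = mat n m (\<lambda>(t, s). \<Sum>i = 1..<n. \<Sum>j = 1..<m.
      c i j * elem_staircase n m i j $$ (t, s))"
    ultimately have S: "S \<in> staircase_mats n m" unfolding staircase_mats_def by blast
    have entry: "S $$ (t, s) = ?f t s - ?f t 0 - ?f 0 s + ?f 0 0" if "t < n" "s < m" for t s
    proof -
      have "S $$ (t, s) = (\<Sum>i = 1..t. \<Sum>j = 1..s. c i j)"
        using that staircase_entry[OF that] by (simp add: S_def)
      also have "\<dots> = (\<Sum>i = 1..t. \<Sum>j = 1..s. ?f i j + ?f (i - 1) (j - 1) - ?f (i - 1) j - ?f i (j - 1))"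
        using that by (intro sum.cong) (auto simp: c_def)
      finally show ?thesis using sum_second_difference[of ?f] by simp
    qed
    have "A = mat n m (\<lambda>(i, j). S $$ (i, j) + vec n (\<lambda>i. ?f i 0) $ i +
        vec m (\<lambda>j. ?f 0 j - ?f 0 0) $ j)"
      using A(1) entry by (intro eq_matI) auto
    then show "A \<in> scaled_staircase_mats n m"
      unfolding scaled_staircase_mats_def using S vec_carrier by blast
  qed
  show "scaled_staircase_mats n m \<subseteq> {A \<in> carrier_mat n m. monge A}"
  proof
    fix A assume "A \<in> scaled_staircase_mats n m"
    then obtain S u v where S: "S \<in> staircase_mats n m"
      and A: "A = mat n m (\<lambda>(i, j). S $$ (i, j) + u $ i + v $ j)"
      unfolding scaled_staircase_mats_def by blast
    obtain c where c: "\<forall>i j. 0 \<le> c i j"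
      and S: "S = mat n m (\<lambda>(t, s). \<Sum>i = 1..<n. \<Sum>j = 1..<m.
        c i j * elem_staircase n m i j $$ (t, s))"
      using S unfolding staircase_mats_def by blast
    have entry: "A $$ (t, s) = (\<Sum>i = 1..t. \<Sum>j = 1..s. c i j) + u $ t + v $ s"
      if "t < n" "s < m" for t s
      using that staircase_entry[OF that, of c] by (simp add: A S)
    have "A $$ (t, s') + A $$ (t', s) \<le> A $$ (t, s) + A $$ (t', s')"
      if ts: "t < t'" "t' < n" "s < s'" "s' < m" for t t' s s'
    proof -
      have split: "(\<Sum>i = 1..t'. g i) = (\<Sum>i\<in>{1..t'} - {1..t}. g i) + (\<Sum>i = 1..t. g i)"
        for g :: "nat \<Rightarrow> real"
        using ts by (intro sum.subset_diff) auto
      have "(\<Sum>i\<in>{1..t'} - {1..t}. \<Sum>j = 1..s. c i j) \<le> (\<Sum>i\<in>{1..t'} - {1..t}. \<Sum>j = 1..s'. c i j)"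
        using ts c by (intro sum_mono sum_mono2) auto
      moreover have t: "t < n" "s < m" using ts by auto
      ultimately show ?thesis
        using split[of "\<lambda>i. \<Sum>j = 1..s. c i j"] split[of "\<lambda>i. \<Sum>j = 1..s'. c i j"]
          entry[OF t(1) ts(4)] entry[OF ts(2) t(2)] entry[OF t] entry[OF ts(2,4)]
        by linarith
    qed
    then show "A \<in> {A \<in> carrier_mat n m. monge A}" by (auto simp: monge_def A)
  qed
qed

section \<open>Products of tropical Jacobi matrices\<close>

lemma rmax_le_sum:
  fixes g :: "'a \<Rightarrow> rmax"
  shows "finite S \<Longrightarrow> x \<in> S \<Longrightarrow> g x \<le> sum g S"
  by (induction S rule: finite_induct) (auto simp: plus_rmax_def max_def)

lemma rmax_sum_le:
  fixes g :: "'a \<Rightarrow> rmax"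
  shows "(\<And>x. x \<in> S \<Longrightarrow> g x \<le> b) \<Longrightarrow> sum g S \<le> b"
  by (induction S rule: infinite_finite_induct) (auto simp: plus_rmax_def)

lemma mat_mult_entry:
  fixes A :: "'a :: comm_semiring_0 mat"
  assumes "A \<in> carrier_mat n n" "B \<in> carrier_mat n n" "i < n" "j < n"
  shows "(A * B) $$ (i, j) = (\<Sum>k = 0..<n. A $$ (i, k) * B $$ (k, j))"
  using assms by (auto simp: scalar_prod_def intro!: sum.cong)

text \<open>The entry \<open>(i, j)\<close> of a product is the largest weight of a path from \<open>i\<close> through some \<open>k\<close> to
  \<open>j\<close>. The two paths behind a product of entries at \<open>(i, j')\<close> and \<open>(i', j)\<close> cross in one of the two
  factors. Exchanging their ends there yields paths from \<open>i\<close> to \<open>j\<close> and from \<open>i'\<close> to \<open>j'\<close>, of no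
  smaller total weight.\<close>

lemma trop_monge_diag_mult:
  assumes "A \<in> trop_monge_diag n" "B \<in> trop_monge_diag n"
  shows "A * B \<in> trop_monge_diag n"
proof -
  have A: "A \<in> carrier_mat n n" "trop_monge n n A" "\<And>i. i < n \<Longrightarrow> A $$ (i, i) \<noteq> MInf"
    and B: "B \<in> carrier_mat n n" "trop_monge n n B" "\<And>i. i < n \<Longrightarrow> B $$ (i, i) \<noteq> MInf"
    using assms by (auto simp: trop_monge_diag_def)
  note entry = mat_mult_entry[OF A(1) B(1)]
  have path: "A $$ (i, k) * B $$ (k, j) \<le> (A * B) $$ (i, j)" if "i < n" "j < n" "k < n" for i j k
    unfolding entry[OF that(1,2)] using that(3) by (intro rmax_le_sum) auto
  have "trop_monge n n (A * B)"
    unfolding mult_monge_def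
  proof (intro allI impI)
    fix i i' j j' assume ij: "i < i' \<and> i' < n \<and> j < j' \<and> j' < n"
    let ?d = "(A * B) $$ (i, j) * (A * B) $$ (i', j')"
    have "(A $$ (i, k) * B $$ (k, j')) * (A $$ (i', l) * B $$ (l, j)) \<le> ?d"
      if kl: "k < n" "l < n" for k l
    proof -
      consider "k \<le> l" | "l < k" by linarith
      then show ?thesis
      proof cases
        case 1
        \<comment> \<open>The paths cross in the second factor, or meet at \<open>k = l\<close>.\<close>
        have "B $$ (k, j') * B $$ (l, j) \<le> B $$ (k, j) * B $$ (l, j')"
          using mult_mongeD[OF B(2), of k l j j'] 1 kl ij by (cases "k = l") (auto simp: mult.commute)
        then have "(A $$ (i, k) * A $$ (i', l)) * (B $$ (k, j') * B $$ (l, j)) \<le>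
            (A $$ (i, k) * A $$ (i', l)) * (B $$ (k, j) * B $$ (l, j'))"
          by (intro mult_left_mono) auto
        also have "\<dots> = (A $$ (i, k) * B $$ (k, j)) * (A $$ (i', l) * B $$ (l, j'))"
          by (simp only: ac_simps)
        also have "\<dots> \<le> ?d" using ij kl by (intro rmax_mult_mono path) auto
        finally show ?thesis by (simp only: ac_simps)
      next
        case 2
        have "A $$ (i, k) * A $$ (i', l) \<le> A $$ (i, l) * A $$ (i', k)"
          using mult_mongeD[OF A(2), of i i' l k] 2 kl ij by simp
        then have "(A $$ (i, k) * A $$ (i', l)) * (B $$ (k, j') * B $$ (l, j)) \<le>
            (A $$ (i, l) * A $$ (i', k)) * (B $$ (k, j') * B $$ (l, j))"
          by (intro mult_right_mono) auto
        also have "\<dots> = (A $$ (i, l) * B $$ (l, j)) * (A $$ (i', k) * B $$ (k, j'))"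
          by (simp only: ac_simps)
        also have "\<dots> \<le> ?d" using ij kl by (intro rmax_mult_mono path) auto
        finally show ?thesis by (simp only: ac_simps)
      qed
    qed
    then have "(\<Sum>k = 0..<n. \<Sum>l = 0..<n.
        (A $$ (i, k) * B $$ (k, j')) * (A $$ (i', l) * B $$ (l, j))) \<le> ?d"
      by (intro rmax_sum_le) auto
    then show "1 * ((A * B) $$ (i, j') * (A * B) $$ (i', j)) \<le> ?d"
      using ij by (simp add: entry sum_product)
  qed
  moreover have "(A * B) $$ (i, i) \<noteq> MInf" if "i < n" for i
    using path[of i i i] A(3)[of i] B(3)[of i] that
    by (cases "A $$ (i, i)"; cases "B $$ (i, i)"; cases "(A * B) $$ (i, i)") auto
  ultimately show ?thesis using A(1) B(1) by (simp add: trop_monge_diag_def)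
qed

text \<open>All finite entries lie on the diagonal or next to it. With \<open>i < i'\<close> and \<open>j < j'\<close>, finite entries
  at both \<open>(i, j')\<close> and \<open>(i', j)\<close> are then only possible at \<open>(i, i + 1)\<close> and \<open>(i + 1, i)\<close>, and a
  Jacobi matrix is finite at no more than one of them.\<close>

lemma jacobi_subset_trop_monge_diag: "jacobi_mats n \<subseteq> trop_monge_diag n"
proof
  fix J assume J: "J \<in> jacobi_mats n"
  then have car: "J \<in> carrier_mat n n" by (simp add: jacobi_mats_def)
  let ?X = "{(i, j). i < n \<and> j < n \<and> J $$ (i, j) \<noteq> 1\<^sub>m n $$ (i, j)}"
  have "?X \<subseteq> {..<n} \<times> {..<n}" by auto
  then have "finite ?X" by (rule finite_subset) auto
  then have single: "p = q" if "p \<in> ?X" "q \<in> ?X" for p q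
    using J that card_le_Suc0_iff_eq[of ?X] by (auto simp: jacobi_mats_def)
  have near: "i = j \<or> (i, j) \<in> ?X \<and> (j = Suc i \<or> i = Suc j)"
    if "i < n" "j < n" "J $$ (i, j) \<noteq> 0" for i j
  proof (cases "i = j")
    case False
    then have "J $$ (i, j) \<noteq> 1\<^sub>m n $$ (i, j)" using that by simp
    then show ?thesis using J that unfolding jacobi_mats_def by blast
  qed simp
  have "J $$ (i, j') = 0 \<or> J $$ (i', j) = 0" if ij: "i < i'" "i' < n" "j < j'" "j' < n" for i i' j j'
  proof (rule ccontr)
    assume "\<not> ?thesis"
    then have "i = j' \<or> (i, j') \<in> ?X \<and> (j' = Suc i \<or> i = Suc j')"
      and "i' = j \<or> (i', j) \<in> ?X \<and> (j = Suc i' \<or> i' = Suc j)"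
      using near[of i j'] near[of i' j] ij by auto
    then have "(i, j') \<in> ?X" "(i', j) \<in> ?X" using ij by auto
    then show False using single[of "(i, j')" "(i', j)"] ij by auto
  qed
  then have "trop_monge n n J" unfolding mult_monge_def by (metis mult_zero_left mult_zero_right rmax_zero_le)
  moreover have "J $$ (i, i) \<noteq> MInf" if "i < n" for i
    using J that by (cases "J $$ (i, i) = 1\<^sub>m n $$ (i, i)") (auto simp: jacobi_mats_def one_rmax_def)
  ultimately show "J \<in> trop_monge_diag n" using car by (simp add: trop_monge_diag_def)
qed

lemma transpose_trop_monge_diag:
  "A \<in> trop_monge_diag n \<Longrightarrow> transpose_mat A \<in> trop_monge_diag n"
  by (auto simp: trop_monge_diag_def mult_monge_def mult.commute)

lemma transpose_jacobi:
  assumes J: "J \<in> jacobi_mats n"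
  shows "transpose_mat J \<in> jacobi_mats n"
proof -
  have car: "J \<in> carrier_mat n n" using J by (simp add: jacobi_mats_def)
  let ?X = "\<lambda>J. {(i, j). i < n \<and> j < n \<and> J $$ (i, j) \<noteq> 1\<^sub>m n $$ (i, j)}"
  have "?X (transpose_mat J) = prod.swap ` ?X J"
    using car by (auto simp: image_iff split: if_splits)
  then have "card (?X (transpose_mat J)) = card (?X J)"
    by (simp add: card_image)
  moreover have "transpose_mat J $$ (i, j) \<noteq> MInf \<and> (i = j \<or> j = Suc i \<or> i = Suc j)"
    if "i < n" "j < n" "transpose_mat J $$ (i, j) \<noteq> 1\<^sub>m n $$ (i, j)" for i j
  proof -
    have "J $$ (j, i) \<noteq> 1\<^sub>m n $$ (j, i)" using that car by (auto split: if_splits)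
    then have "J $$ (j, i) \<noteq> MInf \<and> (j = i \<or> i = Suc j \<or> j = Suc i)"
      using J that(1,2) unfolding jacobi_mats_def by blast
    then show ?thesis using that(1,2) car by auto
  qed
  ultimately show ?thesis using J car unfolding jacobi_mats_def by simp
qed

text \<open>For \<open>i \<noteq> j\<close>, left multiplication by this matrix adds a multiple of row \<open>j\<close> to row \<open>i\<close>, and for
  \<open>i = j\<close> it scales row \<open>i\<close>.\<close>

definition elem_mat :: "nat \<Rightarrow> nat \<Rightarrow> nat \<Rightarrow> rmax \<Rightarrow> rmax mat" where
  "elem_mat n i j c = mat n n (\<lambda>(x, y). if x = i \<and> y = j then c else if x = y then 1 else 0)"

lemma elem_mat_jacobi:
  assumes "i < n" "j < n" "c \<noteq> MInf" "i = j \<or> j = Suc i \<or> i = Suc j"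
  shows "elem_mat n i j c \<in> jacobi_mats n"
proof -
  let ?X = "{(x, y). x < n \<and> y < n \<and> elem_mat n i j c $$ (x, y) \<noteq> 1\<^sub>m n $$ (x, y)}"
  have X: "?X \<subseteq> {(i, j)}" by (auto simp: elem_mat_def split: if_splits)
  then have "card ?X \<le> 1" using card_mono[OF _ X] by simp
  then show ?thesis using assms by (auto simp: jacobi_mats_def elem_mat_def)
qed

lemma elem_mat_add_row:
  assumes A: "A \<in> carrier_mat n n" and "i \<noteq> j" "j < n" "x < n" "y < n"
  shows "(elem_mat n i j c * A) $$ (x, y) =
    (if x = i then max (A $$ (i, y)) (c * A $$ (j, y)) else A $$ (x, y))"
proof -
  have "(elem_mat n i j c * A) $$ (x, y) = (\<Sum>k = 0..<n. elem_mat n i j c $$ (x, k) * A $$ (k, y))"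
    using assms by (intro mat_mult_entry) (auto simp: elem_mat_def)
  also have "\<dots> = (\<Sum>k = 0..<n. (if k = x then A $$ (k, y) else 0) +
      (if k = j then (if x = i then c else 0) * A $$ (k, y) else 0))"
    using assms by (intro sum.cong) (auto simp: elem_mat_def)
  also have "\<dots> = A $$ (x, y) + (if x = i then c else 0) * A $$ (j, y)"
    using assms by (simp add: sum.distrib)
  finally show ?thesis by (simp add: plus_rmax_def zero_rmax_def max_absorb1)
qed

lemma elem_mat_scale_row:
  assumes A: "A \<in> carrier_mat n n" and "x < n" "y < n"
  shows "(elem_mat n i i c * A) $$ (x, y) = (if x = i then c * A $$ (i, y) else A $$ (x, y))"
proof -
  have "(elem_mat n i i c * A) $$ (x, y) = (\<Sum>k = 0..<n. elem_mat n i i c $$ (x, k) * A $$ (k, y))"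
    using assms by (intro mat_mult_entry) (auto simp: elem_mat_def)
  also have "\<dots> = (\<Sum>k = 0..<n. if k = x then (if x = i then c else 1) * A $$ (k, y) else 0)"
    using assms by (intro sum.cong) (auto simp: elem_mat_def)
  also have "\<dots> = (if x = i then c else 1) * A $$ (x, y)"
    using assms by (simp add: sum.delta)
  finally show ?thesis by simp
qed

definition reset_entry :: "nat \<Rightarrow> nat \<Rightarrow> rmax mat \<Rightarrow> rmax mat" where
  "reset_entry i j A = mat (dim_row A) (dim_col A)
     (\<lambda>(x, y). if x = i \<and> y = j then 1\<^sub>m (dim_row A) $$ (x, y) else A $$ (x, y))"

text \<open>In the leftmost column that is not yet zero below the diagonal, the lowest finite entry
  \<open>(i, j)\<close> only occurs in Monge inequalities that are trivial once it is $-\infty$. By the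
  inequalities on rows \<open>i - 1\<close> and \<open>i\<close>, adding to row \<open>i\<close> the multiple of row \<open>i - 1\<close> that
  restores this entry leaves the rest of row \<open>i\<close> unchanged.\<close>

lemma split_off_lower:
  assumes A: "A \<in> trop_monge_diag n"
    and lower: "\<exists>j i. j < i \<and> i < n \<and> A $$ (i, j) \<noteq> MInf"
  obtains i j J where "j < i" "i < n" "A $$ (i, j) \<noteq> MInf" "J \<in> jacobi_mats n"
    "reset_entry i j A \<in> trop_monge_diag n" "A = J * reset_entry i j A"
proof -
  have car: "A \<in> carrier_mat n n" and monge: "trop_monge n n A"
    and diag: "\<And>i. i < n \<Longrightarrow> A $$ (i, i) \<noteq> MInf"
    using A by (auto simp: trop_monge_diag_def)
  obtain j where j: "\<exists>i. j < i \<and> i < n \<and> A $$ (i, j) \<noteq> MInf"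
    and left: "\<And>j' i'. j' < j \<Longrightarrow> j' < i' \<Longrightarrow> i' < n \<Longrightarrow> A $$ (i', j') = MInf"
    using lower exists_least_iff[of "\<lambda>j. \<exists>i. j < i \<and> i < n \<and> A $$ (i, j) \<noteq> MInf"] by blast
  define R where "R = {i. j < i \<and> i < n \<and> A $$ (i, j) \<noteq> MInf}"
  have R: "finite R" "R \<noteq> {}" using j by (auto simp: R_def)
  define i where "i = Max R"
  have i: "j < i" "i < n" "A $$ (i, j) \<noteq> MInf" using Max_in[OF R] by (auto simp: R_def i_def)
  have below: "A $$ (i', j) = MInf" if "i < i'" "i' < n" for i'
  proof (rule ccontr)
    assume "A $$ (i', j) \<noteq> MInf"
    then have "i' \<in> R" using that i(1) by (simp add: R_def)
    then show False using Max_ge[OF R(1)] that(1) unfolding i_def by fastforce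
  qed
  define p where "p = i - 1"
  have p: "i = Suc p" "j \<le> p" "p < n" using i by (auto simp: p_def)
  have "A $$ (p, j) \<noteq> MInf"
  proof (cases "j = p")
    case False
    then have "A $$ (p, p) * A $$ (i, j) \<le> A $$ (p, j) * A $$ (i, p)"
      using mult_mongeD[OF monge, of p i j p] p i by (simp add: mult.commute)
    then show ?thesis using diag[OF p(3)] i(3) by (cases "A $$ (p, p)"; cases "A $$ (i, j)") auto
  qed (use diag p in auto)
  then obtain a b where ab: "A $$ (i, j) = Fin a" "A $$ (p, j) = Fin b"
    using i(3) by (cases "A $$ (i, j)"; cases "A $$ (p, j)") auto
  have "i \<noteq> p" using p(1) by simp
  define J where "J = elem_mat n i p (Fin (a - b))"
  have J: "J \<in> jacobi_mats n" unfolding J_def using i p by (intro elem_mat_jacobi) auto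
  let ?A' = "reset_entry i j A"
  have car': "?A' \<in> carrier_mat n n" using car by (simp add: reset_entry_def)
  have entry: "?A' $$ (x, y) = (if x = i \<and> y = j then MInf else A $$ (x, y))" if "x < n" "y < n" for x y
    using that car i(1) by (auto simp: reset_entry_def zero_rmax_def)
  have le: "?A' $$ (x, y) \<le> A $$ (x, y)" if "x < n" "y < n" for x y
    using entry[OF that] by auto
  have "trop_monge n n ?A'"
    unfolding mult_monge_def
  proof (intro allI impI)
    fix x x' y y' assume xy: "x < x' \<and> x' < n \<and> y < y' \<and> y' < n"
    have "?A' $$ (x', y) = MInf" if "(x, y) = (i, j) \<or> (x', y') = (i, j)"
      using that xy below[of x'] left[of y x'] i entry[of x' y] by auto
    moreover have "?A' $$ (x, y') * ?A' $$ (x', y) \<le> ?A' $$ (x, y) * ?A' $$ (x', y')"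
      if "\<not> ((x, y) = (i, j) \<or> (x', y') = (i, j))"
    proof -
      have "?A' $$ (x, y') * ?A' $$ (x', y) \<le> A $$ (x, y') * A $$ (x', y)"
        using xy by (intro rmax_mult_mono le) auto
      also have "\<dots> \<le> A $$ (x, y) * A $$ (x', y')"
        using mult_mongeD[OF monge, of x x' y y'] xy by simp
      also have "\<dots> = ?A' $$ (x, y) * ?A' $$ (x', y')" using that xy entry[of x y] entry[of x' y'] by auto
      finally show ?thesis .
    qed
    ultimately show "1 * (?A' $$ (x, y') * ?A' $$ (x', y)) \<le> ?A' $$ (x, y) * ?A' $$ (x', y')"
      by fastforce
  qed
  then have A': "?A' \<in> trop_monge_diag n"
    using car' diag entry i(1) by (auto simp: trop_monge_diag_def)
  have "A = J * ?A'"
  proof (rule eq_matI)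
    fix x y assume "x < dim_row (J * ?A')" "y < dim_col (J * ?A')"
    then have xy: "x < n" "y < n" using car' by (auto simp: J_def elem_mat_def)
    have "(J * ?A') $$ (x, y) =
        (if x = i then max (?A' $$ (i, y)) (Fin (a - b) * A $$ (p, y)) else A $$ (x, y))"
      unfolding J_def elem_mat_add_row[OF car' \<open>i \<noteq> p\<close> p(3) xy]
      using entry[OF p(3) xy(2)] entry[OF xy] \<open>i \<noteq> p\<close> by auto
    also have "\<dots> = A $$ (x, y)"
    proof (cases "x = i")
      case True
      consider "y = j" | "y < j" | "j < y" by linarith
      then have "max (?A' $$ (i, y)) (Fin (a - b) * A $$ (p, y)) = A $$ (i, y)"
      proof cases
        case 1
        then show ?thesis using ab entry[OF i(2) xy(2)] by simp
      next
        case 2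
        then show ?thesis using left[of y p] p entry[OF i(2) xy(2)] by simp
      next
        case 3
        have "A $$ (p, y) * A $$ (i, j) \<le> A $$ (p, j) * A $$ (i, y)"
          using mult_mongeD[OF monge, of p i j y] 3 p i xy by simp
        then have "Fin (a - b) * A $$ (p, y) \<le> A $$ (i, y)"
          using ab by (cases "A $$ (p, y)"; cases "A $$ (i, y)") auto
        then show ?thesis using 3 entry[OF i(2) xy(2)] by (simp add: max_absorb1)
      qed
      then show ?thesis using True by simp
    qed simp
    finally show "A $$ (x, y) = (J * ?A') $$ (x, y)" by simp
  qed (use car car' in \<open>auto simp: J_def elem_mat_def\<close>)
  then show ?thesis using that i J A' by blast
qed

lemma split_off_diagonal:
  assumes A: "A \<in> trop_monge_diag n"
    and offdiag: "\<And>x y. x < n \<Longrightarrow> y < n \<Longrightarrow> x \<noteq> y \<Longrightarrow> A $$ (x, y) = MInf" and i: "i < n"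
  obtains J where "J \<in> jacobi_mats n" "reset_entry i i A \<in> trop_monge_diag n"
    "A = J * reset_entry i i A"
proof -
  have car: "A \<in> carrier_mat n n" and diag: "\<And>i. i < n \<Longrightarrow> A $$ (i, i) \<noteq> MInf"
    using A by (auto simp: trop_monge_diag_def)
  let ?A' = "reset_entry i i A"
  have car': "?A' \<in> carrier_mat n n" using car by (simp add: reset_entry_def)
  have entry: "?A' $$ (x, y) = (if x = i \<and> y = i then 1 else A $$ (x, y))" if "x < n" "y < n" for x y
    using that car by (auto simp: reset_entry_def)
  have zero: "?A' $$ (x, y) = MInf" if "x < n" "y < n" "x \<noteq> y" for x y
    using that offdiag by (auto simp: entry)
  have "trop_monge n n ?A'"
    unfolding mult_monge_def
  proof (intro allI impI)
    fix x x' y y' assume "x < x' \<and> x' < n \<and> y < y' \<and> y' < n"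
    then have "?A' $$ (x, y') = MInf \<or> ?A' $$ (x', y) = MInf"
      using zero[of x y'] zero[of x' y] by fastforce
    then show "1 * (?A' $$ (x, y') * ?A' $$ (x', y)) \<le> ?A' $$ (x, y) * ?A' $$ (x', y')"
      by auto
  qed
  then have A': "?A' \<in> trop_monge_diag n"
    using car' diag entry by (auto simp: trop_monge_diag_def one_rmax_def)
  have "A = elem_mat n i i (A $$ (i, i)) * ?A'"
  proof (rule eq_matI)
    fix x y assume "x < dim_row (elem_mat n i i (A $$ (i, i)) * ?A')"
      "y < dim_col (elem_mat n i i (A $$ (i, i)) * ?A')"
    then have xy: "x < n" "y < n" using car' by (auto simp: elem_mat_def)
    then show "A $$ (x, y) = (elem_mat n i i (A $$ (i, i)) * ?A') $$ (x, y)"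
      using offdiag[of i y] by (auto simp: elem_mat_scale_row[OF car'] entry)
  qed (use car car' in \<open>auto simp: elem_mat_def\<close>)
  moreover have "elem_mat n i i (A $$ (i, i)) \<in> jacobi_mats n"
    using i diag by (intro elem_mat_jacobi) auto
  ultimately show ?thesis using that A' by blast
qed

text \<open>Entries above the diagonal are split off on the right, by transposition, and the diagonal
  comes last, because scaling a row is harmless only if the row has no other finite entry.\<close>

lemma trop_monge_diag_split:
  assumes A: "A \<in> trop_monge_diag n" and "A \<noteq> 1\<^sub>m n"
  obtains i j J where "i < n" "j < n" "A $$ (i, j) \<noteq> 1\<^sub>m n $$ (i, j)" "J \<in> jacobi_mats n"
    "reset_entry i j A \<in> trop_monge_diag n" "A = J * reset_entry i j A \<or> A = reset_entry i j A * J"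
proof -
  have car: "A \<in> carrier_mat n n" using A by (simp add: trop_monge_diag_def)
  show ?thesis
  proof (cases "\<exists>j i. j < i \<and> i < n \<and> A $$ (i, j) \<noteq> MInf")
    case lower: True
    obtain i j J where *: "j < i" "i < n" "A $$ (i, j) \<noteq> MInf" "J \<in> jacobi_mats n"
      "reset_entry i j A \<in> trop_monge_diag n" "A = J * reset_entry i j A"
      using split_off_lower[OF A lower] .
    then have "j < n" "A $$ (i, j) \<noteq> 1\<^sub>m n $$ (i, j)" by (simp_all add: zero_rmax_def)
    then show ?thesis using that * by blast
  next
    case not_lower: False
    show ?thesis
    proof (cases "\<exists>j i. j < i \<and> i < n \<and> A $$ (j, i) \<noteq> MInf")
      case True
      then obtain j i where ji: "j < i" "i < n" "A $$ (j, i) \<noteq> MInf" by blast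
      then have "transpose_mat A $$ (i, j) \<noteq> MInf" using car by simp
      with ji have "\<exists>j i. j < i \<and> i < n \<and> transpose_mat A $$ (i, j) \<noteq> MInf" by blast
      then obtain i j J where *: "j < i" "i < n" "transpose_mat A $$ (i, j) \<noteq> MInf" "J \<in> jacobi_mats n"
        "reset_entry i j (transpose_mat A) \<in> trop_monge_diag n"
        "transpose_mat A = J * reset_entry i j (transpose_mat A)"
        by (rule split_off_lower[OF transpose_trop_monge_diag[OF A]])
      have reset: "reset_entry i j (transpose_mat A) = transpose_mat (reset_entry j i A)"
        using car by (intro eq_matI) (auto simp: reset_entry_def)
      have "transpose_mat (transpose_mat A) =
          transpose_mat (J * transpose_mat (reset_entry j i A))"
        using *(6) unfolding reset by (rule arg_cong)
      also have "\<dots> = transpose_mat (transpose_mat (reset_entry j i A)) * transpose_mat J"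
        by (rule transpose_mult[of _ n n _ n])
          (use car *(4) in \<open>auto simp: jacobi_mats_def reset_entry_def\<close>)
      finally have "A = reset_entry j i A * transpose_mat J" by simp
      moreover have "reset_entry j i A \<in> trop_monge_diag n"
        using transpose_trop_monge_diag[OF *(5)] by (simp add: reset)
      moreover have "A $$ (j, i) \<noteq> 1\<^sub>m n $$ (j, i)" using *(1,2,3) car by (simp add: zero_rmax_def)
      moreover have "j < n" using *(1,2) by simp
      ultimately show ?thesis using that[of j i] transpose_jacobi[OF *(4)] *(2) by blast
    next
      case not_upper: False
      have diagonal: "A $$ (x, y) = MInf" if "x < n" "y < n" "x \<noteq> y" for x y
      proof (cases "x < y")
        case True
        then show ?thesis using not_upper that by blast
      next
        case False
        then have "y < x" using that(3) by simp
        then show ?thesis using not_lower that by blast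
      qed
      have "\<exists>x<n. A $$ (x, x) \<noteq> 1\<^sub>m n $$ (x, x)"
      proof (rule ccontr)
        assume "\<not> ?thesis"
        then have "A = 1\<^sub>m n"
          using car diagonal by (intro eq_matI) (auto simp: zero_rmax_def)
        then show False using assms(2) by simp
      qed
      then obtain x where x: "x < n" "A $$ (x, x) \<noteq> 1\<^sub>m n $$ (x, x)" by blast
      obtain J where "J \<in> jacobi_mats n" "reset_entry x x A \<in> trop_monge_diag n"
        "A = J * reset_entry x x A"
        using split_off_diagonal[OF A diagonal x(1)] .
      then show ?thesis using that[of x x J] x by blast
    qed
  qed
qed

text \<open>Each factor that is split off lowers the number of entries that differ from those of the
  identity matrix.\<close>

lemma trop_monge_diag_in_semigroup:
  "A \<in> trop_monge_diag n \<Longrightarrow> A \<in> mat_semigroup (jacobi_mats n)"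
proof (induction "card {(x, y). x < n \<and> y < n \<and> A $$ (x, y) \<noteq> 1\<^sub>m n $$ (x, y)}" arbitrary: A
    rule: less_induct)
  case less
  show ?case
  proof (cases "A = 1\<^sub>m n")
    case True
    have "{(x, y). x < n \<and> y < n \<and> 1\<^sub>m n $$ (x, y) \<noteq> (1\<^sub>m n :: rmax mat) $$ (x, y)} = {}" by auto
    then have "A \<in> jacobi_mats n" using True by (simp add: jacobi_mats_def)
    then show ?thesis by (rule mat_semigroup.gen)
  next
    case False
    let ?X = "\<lambda>A. {(x, y). x < n \<and> y < n \<and> A $$ (x, y) \<noteq> 1\<^sub>m n $$ (x, y)}"
    obtain i j J where *: "i < n" "j < n" "A $$ (i, j) \<noteq> 1\<^sub>m n $$ (i, j)" "J \<in> jacobi_mats n"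
      "reset_entry i j A \<in> trop_monge_diag n" "A = J * reset_entry i j A \<or> A = reset_entry i j A * J"
      using trop_monge_diag_split[OF less.prems False] .
    have "A \<in> carrier_mat n n" using less.prems by (simp add: trop_monge_diag_def)
    then have "?X (reset_entry i j A) \<subseteq> ?X A - {(i, j)}"
      by (auto simp: reset_entry_def split: if_splits)
    moreover have "(i, j) \<in> ?X A" using * by simp
    moreover have "finite (?X A)" by (rule finite_subset[of _ "{..<n} \<times> {..<n}"]) auto
    ultimately have "card (?X (reset_entry i j A)) < card (?X A)"
      by (intro psubset_card_mono) auto
    then have "reset_entry i j A \<in> mat_semigroup (jacobi_mats n)" using less.hyps *(5) by blast
    then show ?thesis using *(4,6) by (metis mat_semigroup.gen mat_semigroup.mult)
  qed
qed

lemma mat_semigroup_jacobi: "mat_semigroup (jacobi_mats n) = trop_monge_diag n"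
proof
  show "mat_semigroup (jacobi_mats n) \<subseteq> trop_monge_diag n"
  proof
    fix A assume "A \<in> mat_semigroup (jacobi_mats n)"
    then show "A \<in> trop_monge_diag n"
      by induction (use jacobi_subset_trop_monge_diag trop_monge_diag_mult in blast)+
  qed
qed (use trop_monge_diag_in_semigroup in blast)

section \<open>The relations between the classes\<close>

lemma zero_mat_trop_monge: "trop_monge n m (0\<^sub>m n m)"
  by (auto simp: mult_monge_def)

lemma one_mat_trop_monge_diag: "1\<^sub>m n \<in> trop_monge_diag n"
  by (auto simp: trop_monge_diag_def mult_monge_def one_rmax_def zero_rmax_def)

theorem theoremC:
  fixes n m :: nat
  assumes "0 < n" and "0 < m"
  shows
   "(TPtrop n m \<subseteq> val_mat ` TP n m \<and>
     (2 \<le> n \<and> 2 \<le> m \<longrightarrow> TPtrop n m \<subset> val_mat ` TP n m) \<and>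
     val_mat ` TP n m = val_mat ` TN_nonzero n m \<and>
     val_mat ` TN_nonzero n m \<subset> val_mat ` TN n m \<and>
     val_mat ` TN n m = TNtrop n m)
  \<and> (TPtrop n m = TPtrop2 n m \<and>
     TPtrop2 n m = map_mat Fin ` {A \<in> carrier_mat n m. strict_monge A} \<and>
     TPtrop2 n m \<subset> SDDtrop n m)
  \<and> (val_mat ` TN_nonzero n m = TNtrop_real n m \<and>
     TNtrop_real n m = map_mat Fin ` {A \<in> carrier_mat n m. monge A} \<and>
     {A \<in> carrier_mat n m. monge A} = scaled_staircase_mats n m)
  \<and> (TNtrop n m = TNtrop2 n m \<and>
     TNtrop2 n m = DDtrop n m)
  \<and> (val_mat ` TP n n \<subseteq> val_mat ` (GL n \<inter> TN n n) \<and>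
     (2 \<le> n \<longrightarrow> val_mat ` TP n n \<subset> val_mat ` (GL n \<inter> TN n n)) \<and>
     val_mat ` (GL n \<inter> TN n n) = mat_semigroup (jacobi_mats n) \<and>
     mat_semigroup (jacobi_mats n) \<subset> val_mat ` TN n n)
  \<and> (val_mat ` (GL n \<inter> TN n n) = {A \<in> TNtrop n n. per A \<noteq> MInf})"
proof (intro conjI impI)
  show sub: "TPtrop n m \<subseteq> val_mat ` TP n m"
    unfolding TPtrop_eq val_TP_eq by (auto simp: strict_mult_monge_def mult_monge_def less_imp_le)
  show "TPtrop n m \<subset> val_mat ` TP n m" if nm: "2 \<le> n \<and> 2 \<le> m"
  proof -
    let ?Z = "mat n m (\<lambda>_. Fin 0)"
    have "?Z \<in> val_mat ` TP n m" by (auto simp: val_TP_eq real_mats_iff mult_monge_def)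
    moreover have "\<not> strict_mult_monge n m (\<lambda>i j. ?Z $$ (i, j))"
    proof
      assume "strict_mult_monge n m (\<lambda>i j. ?Z $$ (i, j))"
      from strict_mult_mongeD[OF this, of 0 1 0 1] show False using nm by simp
    qed
    ultimately show ?thesis using sub unfolding TPtrop_eq by blast
  qed
  show "val_mat ` TP n m = val_mat ` TN_nonzero n m" by (simp only: val_TP_eq)
  show "val_mat ` TN_nonzero n m \<subset> val_mat ` TN n m"
  proof -
    have "0\<^sub>m n m \<in> val_mat ` TN n m" using zero_mat_trop_monge by (simp add: val_TN_eq)
    moreover have "0\<^sub>m n m \<notin> val_mat ` TN_nonzero n m"
      using assms by (auto simp: val_TP_eq real_mats_iff zero_rmax_def)
    moreover have "val_mat ` TN_nonzero n m \<subseteq> val_mat ` TN n m" by (auto simp: TN_nonzero_def)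
    ultimately show ?thesis by blast
  qed
  show "val_mat ` TN n m = TNtrop n m" by (simp only: val_TN_eq TNtrop_eq)
  show "TPtrop n m = TPtrop2 n m" by (simp only: TPtrop_eq)
  show "TPtrop2 n m = map_mat Fin ` {A \<in> carrier_mat n m. strict_monge A}"
    by (simp only: TPtrop_eq map_Fin_strict_monge)
  show "TPtrop2 n m \<subset> SDDtrop n m" using assms by (rule TPtrop2_psubset_SDDtrop)
  show "val_mat ` TN_nonzero n m = TNtrop_real n m"
    by (auto simp: val_TP_eq TNtrop_real_def TNtrop_eq real_mats_iff)
  show "TNtrop_real n m = map_mat Fin ` {A \<in> carrier_mat n m. monge A}"
    by (auto simp: map_Fin_monge TNtrop_real_def TNtrop_eq real_mats_iff)
  show "{A \<in> carrier_mat n m. monge A} = scaled_staircase_mats n m"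
    by (rule monge_eq_scaled_staircase)
  show "TNtrop n m = TNtrop2 n m" "TNtrop2 n m = DDtrop n m" by (simp_all only: TNtrop_eq)
  have GL: "val_mat ` (GL n \<inter> TN n n) = trop_monge_diag n" using assms(1) by (rule val_GL_TN_eq)
  show sub': "val_mat ` TP n n \<subseteq> val_mat ` (GL n \<inter> TN n n)"
    by (auto simp: GL val_TP_eq trop_monge_diag_def real_mats_iff)
  show "val_mat ` TP n n \<subset> val_mat ` (GL n \<inter> TN n n)" if "2 \<le> n"
  proof -
    have "(1\<^sub>m n :: rmax mat) $$ (0, 1) = MInf" using that by (simp add: zero_rmax_def)
    moreover have "0 < n" "1 < n" using that by auto
    ultimately have "1\<^sub>m n \<notin> real_mats n n" unfolding real_mats_iff by blast
    then show ?thesis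
      using sub' one_mat_trop_monge_diag[of n] unfolding GL val_TP_eq by blast
  qed
  show "val_mat ` (GL n \<inter> TN n n) = mat_semigroup (jacobi_mats n)"
    by (simp only: GL mat_semigroup_jacobi)
  show "mat_semigroup (jacobi_mats n) \<subset> val_mat ` TN n n"
  proof -
    have "0\<^sub>m n n \<in> val_mat ` TN n n" using zero_mat_trop_monge by (simp add: val_TN_eq)
    moreover have "0\<^sub>m n n \<notin> trop_monge_diag n"
      using assms(1) by (auto simp: trop_monge_diag_def zero_rmax_def)
    moreover have "trop_monge_diag n \<subseteq> val_mat ` TN n n" by (auto simp: val_TN_eq trop_monge_diag_def)
    ultimately show ?thesis unfolding mat_semigroup_jacobi by blast
  qed
  show "val_mat ` (GL n \<inter> TN n n) = {A \<in> TNtrop n n. per A \<noteq> MInf}"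
    using assms(1) by (simp add: GL trop_monge_diag_eq)
qed

end
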